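(* Work in the theory ZF + DC + R-Unif (Zermelo–Fraenkel set theory without the full Axiom of Choice, together with the Principle of Dependent Choice and the Ramsey uniformization principle). If every set $S\subseteq[\mathbb N]^\infty$ has the Ramsey Property, then there is no infinite maximal almost disjoint family of infinite subsets of $\mathbb N$.
   Context: For a set $X$, $[X]^\infty$ denotes the set of countably infinite subsets of $X$. Ramsey Property: a set $S\subseteq[\mathbb N]^\infty$ has the Ramsey Property if there is $B\in[\mathbb N]^\infty$ such that either $[B]^\infty\subseteq S$ or $[B]^\infty\cap S=\emptyset$. Almost disjoint family: a family $\mathcal A\subseteq[\mathbb N]^\infty$ (so all members are infinite subsets of $\mathbb N$) such that for all $x,y\in\mathcal A$, either $x=y$ or $x\cap y$ is finite. A maximal almost disjoint (mad) family is an almost disjoint family that is not a proper subset of any almost disjoint family. "Infinite mad family" means that the family $\mathcal A$ has infinitely many members. R-Unif (Ramsey uniformization principle) is the following statement: for every Polish space $Y$, every $R\subseteq[\mathbb N]^\infty\times Y$, and every infinite $A\subseteq\mathbb N$ such that $[A]^\infty\subseteq\operatorname{dom}(R)=\{x\in[\mathbb N]^\infty:(\exists y\in Y)\ (x,y)\in R\}$, there are $B\in[A]^\infty$ and a function $\vartheta:[B]^\infty\to Y$ such that $(x,\vartheta(x))\in R$ for all $x\in[B]^\infty$. The Axiom of Choice is not assumed beyond DC. *)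

theory Defs
  imports Main
begin

text \<open>
  HOL has a global choice operator, so ``every set of reals is Ramsey'' is refutable when read
  about HOL sets.  A theorem of \<open>ZF + DC + \<dots>\<close> is therefore stated as a semantic consequence:
  it holds in every structure \<open>('a, mem)\<close> for the language of set theory that satisfies the axioms.
  Only the Separation and Replacement schemas need syntax; all other notions are written directly
  as first-order conditions, with quantifiers over the elements of the structure.
  In particular natural numbers, reals, functions, finiteness and countability are those
  of the structure, not those of HOL.
\<close>

datatype fm = Mem nat nat | Eq nat nat | Neg fm | Conj fm fm | Ex nat fm

primrec sat :: "('a \<Rightarrow> 'a \<Rightarrow> bool) \<Rightarrow> (nat \<Rightarrow> 'a) \<Rightarrow> fm \<Rightarrow> bool" where
  "sat mem v (Mem i j) \<longleftrightarrow> mem (v i) (v j)"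
| "sat mem v (Eq i j) \<longleftrightarrow> v i = v j"
| "sat mem v (Neg p) \<longleftrightarrow> \<not> sat mem v p"
| "sat mem v (Conj p q) \<longleftrightarrow> sat mem v p \<and> sat mem v q"
| "sat mem v (Ex i p) \<longleftrightarrow> (\<exists>x. sat mem (v(i := x)) p)"

locale set_structure =
  fixes mem :: "'a \<Rightarrow> 'a \<Rightarrow> bool" (infix "\<epsilon>" 50)
begin

definition el :: "'a \<Rightarrow> 'a set" where
  "el x = {z. z \<epsilon> x}"

text \<open>HOL sets over \<^typ>\<open>'a\<close> play the role of classes.\<close>

subsection \<open>The axioms of ZF\<close>

definition is_inductive :: "'a \<Rightarrow> bool" where
  "is_inductive w \<longleftrightarrow>
     (\<exists>e\<in>el w. el e = {}) \<and> (\<forall>x\<in>el w. \<exists>y\<in>el w. el y = insert x (el x))"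

definition Extensionality :: bool where
  "Extensionality \<longleftrightarrow> (\<forall>x y. el x = el y \<longrightarrow> x = y)"

definition Foundation :: bool where
  "Foundation \<longleftrightarrow> (\<forall>x. el x \<noteq> {} \<longrightarrow> (\<exists>y\<in>el x. el y \<inter> el x = {}))"

definition Pairing :: bool where
  "Pairing \<longleftrightarrow> (\<forall>a b. \<exists>c. el c = {a, b})"

definition Union_ax :: bool where
  "Union_ax \<longleftrightarrow> (\<forall>a. \<exists>u. el u = (\<Union>x\<in>el a. el x))"

definition Powerset :: bool where
  "Powerset \<longleftrightarrow> (\<forall>a. \<exists>p. el p = {x. el x \<subseteq> el a})"

definition Infinity :: bool where
  "Infinity \<longleftrightarrow> (\<exists>w. is_inductive w)"

text \<open>In both schemas the variables of \<open>\<phi>\<close> other than the displayed ones are parameters,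
  with values given by \<open>v\<close>.\<close>

definition Separation :: bool where
  "Separation \<longleftrightarrow> (\<forall>\<phi> v a. \<exists>y. el y = {x \<in> el a. sat mem (v(0 := x)) \<phi>})"

definition Replacement :: bool where
  "Replacement \<longleftrightarrow> (\<forall>\<phi> v a.
     (\<forall>x\<in>el a. \<exists>!y. sat mem (v(0 := x, 1 := y)) \<phi>) \<longrightarrow>
     (\<exists>b. el b = {y. \<exists>x\<in>el a. sat mem (v(0 := x, 1 := y)) \<phi>}))"

definition ZF :: bool where
  "ZF \<longleftrightarrow> Extensionality \<and> Foundation \<and> Pairing \<and> Union_ax \<and> Powerset \<and> Infinity
     \<and> Separation \<and> Replacement"

subsection \<open>Pairs, functions, natural numbers, finiteness\<close>

text \<open>The element of the structure with extension \<open>C\<close>; meaningful only if there is exactly one,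
  as is the case in ZF wherever \<open>mk\<close> is used below.\<close>

definition mk :: "'a set \<Rightarrow> 'a" where
  "mk C = (THE x. el x = C)"

definition pair :: "'a \<Rightarrow> 'a \<Rightarrow> 'a" where
  "pair a b = mk {mk {a}, mk {a, b}}"

definition cart :: "'a set \<Rightarrow> 'a set \<Rightarrow> 'a set" where
  "cart C D = {pair x y | x y. x \<in> C \<and> y \<in> D}"

text \<open>The functions from \<open>C\<close> to \<open>D\<close> that are elements of the structure.\<close>

definition funs :: "'a set \<Rightarrow> 'a set \<Rightarrow> 'a set" where
  "funs C D = {f. el f \<subseteq> cart C D \<and> (\<forall>x\<in>C. \<exists>!y. pair x y \<epsilon> f)}"

definition app :: "'a \<Rightarrow> 'a \<Rightarrow> 'a" where
  "app f x = (THE y. pair x y \<epsilon> f)"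

definition equinumerous :: "'a set \<Rightarrow> 'a set \<Rightarrow> bool" where
  "equinumerous C D \<longleftrightarrow> (\<exists>f\<in>funs C D. bij_betw (app f) C D)"

definition zero :: 'a where
  "zero = mk {}"

definition suc :: "'a \<Rightarrow> 'a" where
  "suc x = mk (insert x (el x))"

definition NN :: "'a set" where
  "NN = {n. \<forall>w. is_inductive w \<longrightarrow> n \<epsilon> w}"

definition fin :: "'a set \<Rightarrow> bool" where
  "fin C \<longleftrightarrow> (\<exists>n\<in>NN. equinumerous (el n) C)"

definition countable_class :: "'a set \<Rightarrow> bool" where
  "countable_class C \<longleftrightarrow> (\<exists>f\<in>funs C NN. inj_on (app f) C)"

text \<open>\<open>inf_subsets X\<close> is \<open>[X]\<^sup>\<infinity>\<close>.\<close>

definition inf_subsets :: "'a set \<Rightarrow> 'a set" where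
  "inf_subsets X = {x. el x \<subseteq> X \<and> equinumerous NN (el x)}"

subsection \<open>Nonnegative reals\<close>

definition add :: "'a \<Rightarrow> 'a \<Rightarrow> 'a" where
  "add m n = (THE k. \<exists>f\<in>funs NN NN.
     app f zero = m \<and> (\<forall>i\<in>NN. app f (suc i) = suc (app f i)) \<and> app f n = k)"

definition mul :: "'a \<Rightarrow> 'a \<Rightarrow> 'a" where
  "mul m n = (THE k. \<exists>f\<in>funs NN NN.
     app f zero = zero \<and> (\<forall>i\<in>NN. app f (suc i) = add (app f i) m) \<and> app f n = k)"

text \<open>Positive rationals are represented by fractions (not necessarily in lowest terms).\<close>

definition Fracs :: "'a set" where
  "Fracs = cart (NN - {zero}) (NN - {zero})"

definition frac_less :: "'a \<Rightarrow> 'a \<Rightarrow> bool" where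
  "frac_less p q \<longleftrightarrow>
     (\<exists>a b c d. p = pair a b \<and> q = pair c d \<and> mul a d \<epsilon> mul c b)"

definition frac_add :: "'a \<Rightarrow> 'a \<Rightarrow> 'a" where
  "frac_add p q = (THE t. \<exists>a b c d. p = pair a b \<and> q = pair c d \<and>
     t = pair (add (mul a d) (mul c b)) (mul b d))"

text \<open>The reals in \<open>[0,\<infinity>)\<close>, as Dedekind cuts: \<open>r\<close> is the set of all fractions \<open>p\<close> with \<open>r < p\<close>.
  Openness makes each cut closed under equality of fractions.\<close>

definition nnreals :: "'a set" where
  "nnreals = {r. el r \<subseteq> Fracs \<and> el r \<noteq> {} \<and>
     (\<forall>p\<in>el r. \<forall>q\<in>Fracs. frac_less p q \<longrightarrow> q \<epsilon> r) \<and>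
     (\<forall>p\<in>el r. \<exists>q\<in>el r. frac_less q p)}"

definition rzero :: 'a where
  "rzero = mk Fracs"

definition rle :: "'a \<Rightarrow> 'a \<Rightarrow> bool" where
  "rle r s \<longleftrightarrow> el s \<subseteq> el r"

definition rless :: "'a \<Rightarrow> 'a \<Rightarrow> bool" where
  "rless r s \<longleftrightarrow> rle r s \<and> r \<noteq> s"

definition radd :: "'a \<Rightarrow> 'a \<Rightarrow> 'a" where
  "radd r s = mk {t \<in> Fracs. \<exists>p\<in>el r. \<exists>q\<in>el s. frac_less (frac_add p q) t}"

definition pos_reals :: "'a set" where
  "pos_reals = {r \<in> nnreals. rless rzero r}"

subsection \<open>Polish spaces\<close>

definition dst :: "'a \<Rightarrow> 'a \<Rightarrow> 'a \<Rightarrow> 'a" where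
  "dst d x y = app d (pair x y)"

definition metric :: "'a \<Rightarrow> 'a \<Rightarrow> bool" where
  "metric Y d \<longleftrightarrow> d \<in> funs (cart (el Y) (el Y)) nnreals \<and>
     (\<forall>x\<in>el Y. \<forall>y\<in>el Y. dst d x y = rzero \<longleftrightarrow> x = y) \<and>
     (\<forall>x\<in>el Y. \<forall>y\<in>el Y. dst d x y = dst d y x) \<and>
     (\<forall>x\<in>el Y. \<forall>y\<in>el Y. \<forall>z\<in>el Y. rle (dst d x z) (radd (dst d x y) (dst d y z)))"

definition induces :: "'a \<Rightarrow> 'a \<Rightarrow> 'a \<Rightarrow> bool" where
  "induces Y d T \<longleftrightarrow> (\<forall>U. U \<epsilon> T \<longleftrightarrow> el U \<subseteq> el Y \<and>
     (\<forall>x\<in>el U. \<exists>r\<in>pos_reals. \<forall>y\<in>el Y. rless (dst d x y) r \<longrightarrow> y \<epsilon> U))"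

definition Cauchy_seq :: "'a \<Rightarrow> 'a \<Rightarrow> bool" where
  "Cauchy_seq d s \<longleftrightarrow> (\<forall>r\<in>pos_reals. \<exists>k\<in>NN. \<forall>m\<in>NN. \<forall>n\<in>NN.
     el k \<subseteq> el m \<and> el k \<subseteq> el n \<longrightarrow> rless (dst d (app s m) (app s n)) r)"

definition converges_to :: "'a \<Rightarrow> 'a \<Rightarrow> 'a \<Rightarrow> bool" where
  "converges_to d s x \<longleftrightarrow> (\<forall>r\<in>pos_reals. \<exists>k\<in>NN. \<forall>n\<in>NN.
     el k \<subseteq> el n \<longrightarrow> rless (dst d (app s n) x) r)"

definition complete_metric :: "'a \<Rightarrow> 'a \<Rightarrow> bool" where
  "complete_metric Y d \<longleftrightarrow> metric Y d \<and>
     (\<forall>s\<in>funs NN (el Y). Cauchy_seq d s \<longrightarrow> (\<exists>x\<in>el Y. converges_to d s x))"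

definition separable :: "'a \<Rightarrow> 'a \<Rightarrow> bool" where
  "separable Y T \<longleftrightarrow> (\<exists>D. el D \<subseteq> el Y \<and> countable_class (el D) \<and>
     (\<forall>U\<in>el T. el U \<noteq> {} \<longrightarrow> el U \<inter> el D \<noteq> {}))"

text \<open>\<open>Y\<close> with the topology \<open>T\<close> is separable and completely metrizable; that \<open>T\<close> is a topology
  follows from its being induced by a metric.\<close>

definition Polish :: "'a \<Rightarrow> 'a \<Rightarrow> bool" where
  "Polish Y T \<longleftrightarrow> separable Y T \<and> (\<exists>d. complete_metric Y d \<and> induces Y d T)"

subsection \<open>Dependent choice, Ramsey uniformization, mad families\<close>

definition DC :: bool where
  "DC \<longleftrightarrow> (\<forall>X R. el X \<noteq> {} \<and> el R \<subseteq> cart (el X) (el X) \<and>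
     (\<forall>x\<in>el X. \<exists>y\<in>el X. pair x y \<epsilon> R) \<longrightarrow>
     (\<exists>f\<in>funs NN (el X). \<forall>n\<in>NN. pair (app f n) (app f (suc n)) \<epsilon> R))"

definition R_Unif :: bool where
  "R_Unif \<longleftrightarrow> (\<forall>Y T R A. Polish Y T \<and> el R \<subseteq> cart (inf_subsets NN) (el Y) \<and>
     el A \<subseteq> NN \<and> \<not> fin (el A) \<and>
     inf_subsets (el A) \<subseteq> {x \<in> inf_subsets NN. \<exists>y\<in>el Y. pair x y \<epsilon> R} \<longrightarrow>
     (\<exists>B\<in>inf_subsets (el A). \<exists>\<theta>\<in>funs (inf_subsets (el B)) (el Y).
        \<forall>x\<in>inf_subsets (el B). pair x (app \<theta> x) \<epsilon> R))"

definition Ramsey_property :: "'a \<Rightarrow> bool" where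
  "Ramsey_property S \<longleftrightarrow> (\<exists>B\<in>inf_subsets NN.
     inf_subsets (el B) \<subseteq> el S \<or> inf_subsets (el B) \<inter> el S = {})"

definition almost_disjoint :: "'a \<Rightarrow> bool" where
  "almost_disjoint A \<longleftrightarrow> el A \<subseteq> inf_subsets NN \<and>
     (\<forall>x\<in>el A. \<forall>y\<in>el A. x = y \<or> fin (el x \<inter> el y))"

definition mad :: "'a \<Rightarrow> bool" where
  "mad A \<longleftrightarrow> almost_disjoint A \<and> \<not> (\<exists>B. almost_disjoint B \<and> el A \<subset> el B)"

end

end

theory Submission
  imports Defs
begin

text \<open>
  Let \<open>A\<close> be an infinite mad family, let \<open>A\<^sub>0, A\<^sub>1, \<dots>\<close> be distinct members of it (given by DC), and let
  \<open>a(m,n)\<close> be the least element of \<open>A\<^sub>m\<close> above \<open>n\<close>. Let \<open>S\<close> be the set of all \<open>z = {z\<^sub>0 < z\<^sub>1 < \<dots>}\<close> such that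
  some \<open>y \<in> A\<close> contains \<open>a(z\<^bsub>2i\<^esub>, z\<^bsub>2i+1\<^esub>)\<close> for all \<open>i\<close>. No infinite set \<open>B\<close> is homogeneous for \<open>S\<close>.

  By maximality some \<open>y \<in> A\<close> contains infinitely many of the numbers \<open>a(b\<^bsub>2i\<^esub>, b\<^bsub>2i+1\<^esub>)\<close>, where
  \<open>B = {b\<^sub>0 < b\<^sub>1 < \<dots>}\<close>; the union of the corresponding pairs \<open>{b\<^bsub>2i\<^esub>, b\<^bsub>2i+1\<^esub>}\<close> is a subset of \<open>B\<close> in \<open>S\<close>.
  Suppose now that all infinite subsets of \<open>B\<close> are in \<open>S\<close>, and let \<open>y\<close> witness that \<open>B\<close> is. For \<open>b < c\<close> in
  \<open>B\<close>, let \<open>y'\<close> be a witness for \<open>{b, c} \<union> {x \<in> B. x \<ge> b\<^bsub>2i\<^esub>}\<close>, where \<open>b\<^bsub>2i\<^esub> > c\<close>. It has infinitely many elements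
  in common with \<open>y\<close>, so \<open>y' = y\<close>, and hence \<open>a(b,c) \<in> y\<close>. As \<open>c\<close> varies, this gives \<open>A\<^sub>b = y\<close>, for each
  \<open>b \<in> B\<close>, although the \<open>A\<^sub>b\<close> are distinct.
\<close>

section \<open>Finite support and renaming of variables in formulas\<close>

text \<open>Only the finitely many variables occurring in a formula matter. This supplies fresh
  bound variables for the renaming below.\<close>

lemma sat_finite_support:
  "\<exists>n::nat. \<forall>v w. (\<forall>i<n. v i = w i) \<longrightarrow> sat mem v \<phi> = sat mem w \<phi>"
proof (induction \<phi>)
  case (Mem i j)
  show ?case by (rule exI[of _ "Suc (max i j)"]) (simp add: less_Suc_eq_le)
next
  case (Eq i j)
  show ?case by (rule exI[of _ "Suc (max i j)"]) (simp add: less_Suc_eq_le)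
next
  case (Neg p)
  then show ?case by simp
next
  case (Conj p q)
  obtain m where m: "\<forall>v w. (\<forall>i<m. v i = w i) \<longrightarrow> sat mem v p = sat mem w p"
    using Conj.IH(1) ..
  obtain n where n: "\<forall>v w. (\<forall>i<n. v i = w i) \<longrightarrow> sat mem v q = sat mem w q"
    using Conj.IH(2) ..
  show ?case
  proof (intro exI allI impI)
    fix v w :: "nat \<Rightarrow> 'a"
    assume "\<forall>i<max m n. v i = w i"
    then show "sat mem v (Conj p q) = sat mem w (Conj p q)"
      using m[rule_format, of v w] n[rule_format, of v w] by simp
  qed
next
  case (Ex i p)
  obtain n where n: "\<forall>v w. (\<forall>i<n. v i = w i) \<longrightarrow> sat mem v p = sat mem w p"
    using Ex.IH ..
  show ?case
  proof (intro exI allI impI)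
    fix v w :: "nat \<Rightarrow> 'a"
    assume "\<forall>j<n. v j = w j"
    then have "sat mem (v(i := x)) p = sat mem (w(i := x)) p" for x
      by (intro n[rule_format]) simp
    then show "sat mem v (fm.Ex i p) = sat mem w (fm.Ex i p)" by simp
  qed
qed

text \<open>Bound variables are changed along with the free ones, so \<open>\<rho>\<close> need not
  be injective. Renaming serves to separate the variables of two formulas and to merge several
  variables into one.\<close>

lemma sat_rename: "\<exists>\<psi>. \<forall>v. sat mem v \<psi> = sat mem (\<lambda>i. v (\<rho> i)) \<phi>"
proof (induction \<phi> arbitrary: \<rho>)
  case (Mem i j)
  show ?case by (rule exI[of _ "Mem (\<rho> i) (\<rho> j)"]) simp
next
  case (Eq i j)
  show ?case by (rule exI[of _ "Eq (\<rho> i) (\<rho> j)"]) simp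
next
  case (Neg p)
  obtain \<psi> where "\<forall>v. sat mem v \<psi> = sat mem (\<lambda>i. v (\<rho> i)) p" using Neg[of \<rho>] ..
  then show ?case by (intro exI[of _ "Neg \<psi>"]) simp
next
  case (Conj p q)
  obtain \<psi> where "\<forall>v. sat mem v \<psi> = sat mem (\<lambda>i. v (\<rho> i)) p" using Conj(1)[of \<rho>] ..
  moreover obtain \<chi> where "\<forall>v. sat mem v \<chi> = sat mem (\<lambda>i. v (\<rho> i)) q" using Conj(2)[of \<rho>] ..
  ultimately show ?case by (intro exI[of _ "Conj \<psi> \<chi>"]) simp
next
  case (Ex i p)
  obtain n where n: "\<forall>v w. (\<forall>i<n. v i = w i) \<longrightarrow> sat mem v p = sat mem w p"
    using sat_finite_support[of mem p] ..
  \<comment> \<open>\<open>k\<close> lies outside the image under \<open>\<rho>\<close> of the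
    variables that matter to \<open>p\<close>, so binding \<open>k\<close> in place of
    \<open>i\<close> captures nothing.\<close>
  define k where "k = Suc (Max (insert 0 (\<rho> ` {..<n})))"
  have k: "\<rho> j \<noteq> k" if "j < n" for j
  proof -
    have "\<rho> j \<le> Max (insert 0 (\<rho> ` {..<n}))" by (rule Max_ge) (use that in auto)
    then show ?thesis unfolding k_def by linarith
  qed
  obtain \<psi> where \<psi>: "\<forall>v. sat mem v \<psi> = sat mem (\<lambda>j. v ((\<rho>(i := k)) j)) p"
    using Ex[of "\<rho>(i := k)"] ..
  have "sat mem (v(k := x)) \<psi> = sat mem ((\<lambda>j. v (\<rho> j))(i := x)) p" for v x
    unfolding \<psi>[rule_format] by (rule n[rule_format]) (simp add: k)
  then show ?case by (intro exI[of _ "fm.Ex k \<psi>"]) simp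
qed

context set_structure
begin

section \<open>Definability with parameters\<close>

text \<open>Assignments are read in the style of de Bruijn: the innermost bound variable is \<open>e 0\<close>.
  The map \<open>s\<close> says for each variable of the formula whether it stands for an entry of the assignment
  or for a parameter.\<close>

definition definable :: "((nat \<Rightarrow> 'a) \<Rightarrow> bool) \<Rightarrow> bool" where
  "definable P \<longleftrightarrow> (\<exists>\<phi> s. \<forall>e. P e = sat (\<epsilon>) (\<lambda>i. case s i of Inl j \<Rightarrow> e j | Inr c \<Rightarrow> c) \<phi>)"

text \<open>The language has no function symbols, so an operation is treated through its graph: slot
  0 holds the value, and the arguments move up by one.\<close>

definition definable_term :: "((nat \<Rightarrow> 'a) \<Rightarrow> 'a) \<Rightarrow> bool" where
  "definable_term t \<longleftrightarrow> definable (\<lambda>e. e 0 = t (\<lambda>n. e (Suc n)))"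

lemma definable_reindex:
  assumes "definable P"
  shows "definable (\<lambda>e. P (\<lambda>n. e (f n)))"
proof -
  obtain \<phi> s where "\<And>e. P e = sat (\<epsilon>) (\<lambda>i. case s i of Inl j \<Rightarrow> e j | Inr c \<Rightarrow> c) \<phi>"
    using assms unfolding definable_def by blast
  moreover have "(\<lambda>i. case map_sum f id (s i) of Inl j \<Rightarrow> e j | Inr c \<Rightarrow> c)
      = (\<lambda>i. case s i of Inl j \<Rightarrow> e (f j) | Inr c \<Rightarrow> c)" for e :: "nat \<Rightarrow> 'a"
    by (auto split: sum.split)
  ultimately show ?thesis
    unfolding definable_def by (intro exI[of _ \<phi>] exI[of _ "\<lambda>i. map_sum f id (s i)"]) simp
qed

lemma definable_not: "definable P \<Longrightarrow> definable (\<lambda>e. \<not> P e)"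
  unfolding definable_def by (metis sat.simps(3))

text \<open>The two formulas may use the same variable for different entries or parameters. Moving
  one to the even and the other to the odd variables lets a single map serve both.\<close>

lemma definable_conj:
  assumes "definable P" "definable Q"
  shows "definable (\<lambda>e. P e \<and> Q e)"
proof -
  obtain \<phi> s where \<phi>: "\<And>e. P e = sat (\<epsilon>) (\<lambda>i. case s i of Inl j \<Rightarrow> e j | Inr c \<Rightarrow> c) \<phi>"
    using assms unfolding definable_def by blast
  obtain \<psi> t where \<psi>: "\<And>e. Q e = sat (\<epsilon>) (\<lambda>i. case t i of Inl j \<Rightarrow> e j | Inr c \<Rightarrow> c) \<psi>"
    using assms unfolding definable_def by blast
  obtain \<phi>' where \<phi>': "\<And>v. sat (\<epsilon>) v \<phi>' = sat (\<epsilon>) (\<lambda>i. v (2 * i)) \<phi>"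
    using sat_rename[of "(\<epsilon>)" "\<lambda>i. 2 * i" \<phi>] by blast
  obtain \<psi>' where \<psi>': "\<And>v. sat (\<epsilon>) v \<psi>' = sat (\<epsilon>) (\<lambda>i. v (2 * i + 1)) \<psi>"
    using sat_rename[of "(\<epsilon>)" "\<lambda>i. 2 * i + 1" \<psi>] by blast
  show ?thesis
    unfolding definable_def
    by (intro exI[of _ "Conj \<phi>' \<psi>'"] exI[of _ "\<lambda>i. if even i then s (i div 2) else t (i div 2)"])
       (simp add: \<phi> \<psi> \<phi>' \<psi>')
qed

text \<open>Several variables of \<open>\<phi>\<close> may stand for the innermost entry. They are
  all merged into variable 0, which is then quantified, and the others move up by one.\<close>

lemma definable_ex:
  assumes "definable (\<lambda>e. P (\<lambda>n. e (Suc n)) (e 0))"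
  shows "definable (\<lambda>e. \<exists>x. P e x)"
proof -
  obtain \<phi> s where \<phi>: "\<And>e. P (\<lambda>n. e (Suc n)) (e 0)
      = sat (\<epsilon>) (\<lambda>i. case s i of Inl j \<Rightarrow> e j | Inr c \<Rightarrow> c) \<phi>"
    using assms unfolding definable_def by blast
  obtain \<psi> where \<psi>: "\<And>v. sat (\<epsilon>) v \<psi> = sat (\<epsilon>) (\<lambda>i. v (if s i = Inl 0 then 0 else Suc i)) \<phi>"
    using sat_rename[of "(\<epsilon>)" "\<lambda>i. if s i = Inl 0 then 0 else Suc i" \<phi>] by blast
  \<comment> \<open>For positive \<open>i\<close> this undoes the shift of variables and lowers the
    entries by one, since slot 0 is now bound. The value \<open>t 0\<close> is overwritten by
    \<open>x\<close>.\<close>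
  define t where "t i = map_sum (\<lambda>j. j - 1) id (s (i - 1))" for i
  have "P e x = sat (\<epsilon>) ((\<lambda>i. case t i of Inl j \<Rightarrow> e j | Inr c \<Rightarrow> c)(0 := x)) \<psi>" for e x
  proof -
    have "(\<lambda>i. case s i of Inl j \<Rightarrow> (case_nat x e) j | Inr c \<Rightarrow> c)
      = (\<lambda>i. ((\<lambda>i. case t i of Inl j \<Rightarrow> e j | Inr c \<Rightarrow> c)(0 := x)) (if s i = Inl 0 then 0 else Suc i))"
      by (auto simp: t_def fun_eq_iff split: sum.split nat.split)
    then show ?thesis using \<phi>[of "case_nat x e"] by (simp add: \<psi>)
  qed
  then have "\<forall>e. (\<exists>x. P e x)
      = sat (\<epsilon>) (\<lambda>i. case t i of Inl j \<Rightarrow> e j | Inr c \<Rightarrow> c) (fm.Ex 0 \<psi>)"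
    unfolding sat.simps by blast
  then show ?thesis
    unfolding definable_def by blast
qed

lemma definable_disj:
  assumes "definable P" "definable Q"
  shows "definable (\<lambda>e. P e \<or> Q e)"
proof -
  have "definable (\<lambda>e. \<not> (\<not> P e \<and> \<not> Q e))"
    by (rule definable_not, rule definable_conj; rule definable_not, rule assms)
  then show ?thesis by (simp only: de_Morgan_conj not_not)
qed

lemma definable_imp:
  assumes "definable P" "definable Q"
  shows "definable (\<lambda>e. P e \<longrightarrow> Q e)"
  unfolding imp_conv_disj by (rule definable_disj, rule definable_not; rule assms)

lemma definable_iff:
  assumes "definable P" "definable Q"
  shows "definable (\<lambda>e. P e = Q e)"
proof -
  have "definable (\<lambda>e. (P e \<longrightarrow> Q e) \<and> (Q e \<longrightarrow> P e))"
    by (rule definable_conj; rule definable_imp; rule assms)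
  moreover have "(\<lambda>e. (P e \<longrightarrow> Q e) \<and> (Q e \<longrightarrow> P e)) = (\<lambda>e. P e = Q e)" by blast
  ultimately show ?thesis by simp
qed

lemma definable_all:
  assumes "definable (\<lambda>e. P (\<lambda>n. e (Suc n)) (e 0))"
  shows "definable (\<lambda>e. \<forall>x. P e x)"
proof -
  have "definable (\<lambda>e. \<not> (\<exists>x. \<not> P e x))"
    by (rule definable_not, rule definable_ex, rule definable_not, rule assms)
  then show ?thesis by (simp only: not_ex not_not)
qed

lemma definable_var_eq: "definable (\<lambda>e. e i = e j)"
  unfolding definable_def
  by (intro exI[of _ "Eq 0 1"] exI[of _ "\<lambda>k. if k = 0 then Inl i else Inl j"]) simp

lemma definable_term_var: "definable_term (\<lambda>e. e i)"
  unfolding definable_term_def by (rule definable_var_eq)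

lemma definable_term_const: "definable_term (\<lambda>e. c)"
  unfolding definable_term_def definable_def
  by (intro exI[of _ "Eq 0 1"] exI[of _ "\<lambda>k. if k = 0 then Inl 0 else Inr c"]) simp

text \<open>A term is eliminated by quantifying over its value, which is pinned down by the
  graph.\<close>

lemma definable_subst:
  assumes "definable_term t" "definable (\<lambda>e. P (\<lambda>n. e (Suc n)) (e 0))"
  shows "definable (\<lambda>e. P e (t e))"
proof -
  have "definable (\<lambda>e. \<exists>x. x = t e \<and> P e x)"
    using assms unfolding definable_term_def by (intro definable_ex definable_conj)
  then show ?thesis by simp
qed

lemma definable_term_reindex:
  assumes "definable_term t"
  shows "definable_term (\<lambda>e. t (\<lambda>n. e (f n)))"
  using definable_reindex[OF assms[unfolded definable_term_def], of "case_nat 0 (\<lambda>n. Suc (f n))"]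
  by (simp add: definable_term_def)

lemma definable_subst2:
  assumes "definable_term s" "definable_term t" "definable (\<lambda>e. P (e 0) (e 1))"
  shows "definable (\<lambda>e. P (s e) (t e))"
proof (rule definable_subst[of s "\<lambda>e x. P x (t e)"])
  show "definable (\<lambda>e. P (e 0) (t (\<lambda>n. e (Suc n))))"
  proof (rule definable_subst[of "\<lambda>e. t (\<lambda>n. e (Suc n))" "\<lambda>e x. P (e 0) x"])
    show "definable (\<lambda>e. P (e (Suc 0)) (e 0))"
      using definable_reindex[OF assms(3), of "\<lambda>i. 1 - i"] by simp
  qed (rule definable_term_reindex, rule assms)
qed (rule assms)

lemma definable_mem:
  assumes "definable_term s" "definable_term t"
  shows "definable (\<lambda>e. s e \<epsilon> t e)"
proof (rule definable_subst2[OF assms])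
  show "definable (\<lambda>e. e 0 \<epsilon> e 1)"
    unfolding definable_def by (intro exI[of _ "Mem 0 1"] exI[of _ Inl]) simp
qed

lemma definable_eq:
  assumes "definable_term s" "definable_term t"
  shows "definable (\<lambda>e. s e = t e)"
  using assms definable_var_eq by (rule definable_subst2)

lemma definable_in_el:
  "definable_term s \<Longrightarrow> definable_term t \<Longrightarrow> definable (\<lambda>e. s e \<in> el (t e))"
  unfolding el_def mem_Collect_eq by (rule definable_mem)

lemma definable_all_mem:
  "definable (\<lambda>e. e 0 \<in> C (\<lambda>n. e (Suc n))) \<Longrightarrow> definable (\<lambda>e. P (\<lambda>n. e (Suc n)) (e 0))
    \<Longrightarrow> definable (\<lambda>e. \<forall>x\<in>C e. P e x)"
  unfolding Ball_def by (intro definable_all definable_imp)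

lemma definable_ex_mem:
  "definable (\<lambda>e. e 0 \<in> C (\<lambda>n. e (Suc n))) \<Longrightarrow> definable (\<lambda>e. P (\<lambda>n. e (Suc n)) (e 0))
    \<Longrightarrow> definable (\<lambda>e. \<exists>x\<in>C e. P e x)"
  unfolding Bex_def by (intro definable_ex definable_conj)

lemma definable_ex1:
  assumes "definable (\<lambda>e. P (\<lambda>n. e (Suc n)) (e 0))"
  shows "definable (\<lambda>e. \<exists>!x. P e x)"
proof -
  \<comment> \<open>In the uniqueness clause \<open>P\<close> stands under two quantifiers: slot 0
    is the competing value, and slot 1, the claimed value, is skipped.\<close>
  have "definable (\<lambda>e. P (\<lambda>n. e (Suc (Suc n))) (e 0))"
    using definable_reindex[OF assms, of "case_nat 0 (\<lambda>n. Suc (Suc n))"] by simp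
  then show ?thesis unfolding Ex1_def
    by (intro definable_ex definable_conj definable_all definable_imp assms definable_eq
        definable_term_var)
qed

lemma definable_el_subset:
  assumes "definable_term s" "definable_term t"
  shows "definable (\<lambda>e. el (s e) \<subseteq> el (t e))"
  unfolding subset_eq
  by (intro definable_all_mem definable_in_el definable_term_reindex[OF assms(1)]
      definable_term_reindex[OF assms(2)] definable_term_var)

lemma definable_termI:
  "definable (\<lambda>e. e 0 = t (\<lambda>n. e (Suc n))) \<Longrightarrow> definable_term t"
  by (simp add: definable_term_def)

lemmas definable_intros = definable_not definable_conj definable_disj definable_imp definable_iff
  definable_all_mem definable_ex_mem definable_all definable_ex definable_ex1 definable_mem
  definable_eq definable_in_el definable_el_subset definable_term_var definable_term_const

definition isset :: "'a set \<Rightarrow> bool" where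
  "isset C \<longleftrightarrow> (\<exists>x. el x = C)"

lemma isset_el [simp, intro]: "isset (el x)"
  by (auto simp: isset_def)

end

locale zf_structure = set_structure mem for mem :: "'a \<Rightarrow> 'a \<Rightarrow> bool" (infix "\<epsilon>" 50) +
  assumes ZF: ZF
begin

section \<open>Elementary set theory\<close>

lemma ext: "el x = el y \<Longrightarrow> x = y"
  using ZF unfolding ZF_def Extensionality_def by simp

lemma el_mk [simp]: "isset C \<Longrightarrow> el (mk C) = C"
  unfolding mk_def isset_def
proof (elim exE)
  fix x
  assume x: "el x = C"
  show "el (THE x. el x = C) = C"
    by (rule theI2[of "\<lambda>x. el x = C"], rule x, rule ext, simp only: x)
qed

lemma mem_mk: "isset C \<Longrightarrow> x \<epsilon> mk C \<longleftrightarrow> x \<in> C"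
  using el_mk[of C] by (simp add: el_def set_eq_iff)

lemma isset_pair [simp]: "isset {a, b}"
  using ZF unfolding ZF_def Pairing_def isset_def by blast

lemma isset_singleton [simp]: "isset {a}"
  using isset_pair[of a a] by simp

lemma isset_Un:
  assumes "isset C" "isset D"
  shows "isset (C \<union> D)"
proof -
  obtain u where "el u = (\<Union>x\<in>el (mk {mk C, mk D}). el x)"
    using ZF unfolding ZF_def Union_ax_def by blast
  then have "el u = C \<union> D" using assms by simp
  then show ?thesis unfolding isset_def ..
qed

lemma isset_insert [simp]: "isset C \<Longrightarrow> isset (insert a C)"
  using isset_Un[of "{a}" C] by simp

lemma isset_Pow: "isset {x. el x \<subseteq> el a}"
  using ZF unfolding ZF_def Powerset_def isset_def by blast

text \<open>The Separation schema in semantic form. As \<open>P\<close> looks at \<open>e 0\<close>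
  only, the assignment may be taken constant, so all variables standing for entries can be merged
  into variable 0; the parameters occupy the positive variables.\<close>

lemma isset_sep:
  assumes "isset C" "definable (\<lambda>e. P (e 0))"
  shows "isset {x \<in> C. P x}"
proof -
  from assms(2) obtain \<phi> s
    where \<phi>: "\<forall>e :: nat \<Rightarrow> 'a. P (e 0) = sat (\<epsilon>) (\<lambda>i. case s i of Inl j \<Rightarrow> e j | Inr c \<Rightarrow> c) \<phi>"
    unfolding definable_def by (elim exE)
  from sat_rename obtain \<psi>
    where \<psi>: "\<forall>v. sat (\<epsilon>) v \<psi> = sat (\<epsilon>) (\<lambda>i. v (if isl (s i) then 0 else Suc i)) \<phi>" ..
  define v where "v i = projr (s (i - 1))" for i
  have "P x = sat (\<epsilon>) (v(0 := x)) \<psi>" for x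
  proof -
    have "(\<lambda>i. case s i of Inl j \<Rightarrow> x | Inr c \<Rightarrow> c)
      = (\<lambda>i. (v(0 := x)) (if isl (s i) then 0 else Suc i))"
      by (simp add: v_def fun_eq_iff split: sum.split)
    then show ?thesis using \<phi>[rule_format, of "\<lambda>_. x"] by (simp add: \<psi>[rule_format])
  qed
  moreover obtain a where "C = el a" using assms(1) unfolding isset_def by blast
  moreover have "\<exists>y. el y = {x \<in> el a. sat (\<epsilon>) (v(0 := x)) \<psi>}" for a
    using ZF unfolding ZF_def Separation_def by (elim conjE allE)
  ultimately show ?thesis unfolding isset_def by simp
qed

lemma isset_Diff_singleton:
  assumes "isset C"
  shows "isset (C - {a})"
proof -
  have "isset {x \<in> C. x \<noteq> a}" by (intro isset_sep assms definable_intros)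
  moreover have "{x \<in> C. x \<noteq> a} = C - {a}" by auto
  ultimately show ?thesis by simp
qed

lemma isset_Int: "isset (el x \<inter> el y)"
proof -
  have "isset {z \<in> el x. z \<in> el y}" by (intro isset_sep isset_el definable_intros)
  moreover have "{z \<in> el x. z \<in> el y} = el x \<inter> el y" by auto
  ultimately show ?thesis by simp
qed

lemma isset_empty [simp]: "isset {}"
  using ZF unfolding ZF_def Infinity_def is_inductive_def isset_def by blast

lemma el_pair: "el (pair a b) = {mk {a}, mk {a, b}}"
  by (simp add: pair_def)

lemma mk_inject: "isset C \<Longrightarrow> isset D \<Longrightarrow> mk C = mk D \<longleftrightarrow> C = D"
  using el_mk by metis

lemma pair_inject [simp]: "pair a b = pair c d \<longleftrightarrow> a = c \<and> b = d"
  unfolding pair_def by (simp add: mk_inject) (auto simp: doubleton_eq_iff mk_inject)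

lemma definable_term_mk_pair:
  assumes "definable_term s" "definable_term t"
  shows "definable_term (\<lambda>e. mk {s e, t e})"
proof (rule definable_termI)
  have "x = mk {a, b} \<longleftrightarrow> (\<forall>z. z \<epsilon> x \<longleftrightarrow> z = a \<or> z = b)" for x a b
  proof -
    have "x = mk {a, b} \<longleftrightarrow> el x = el (mk {a, b})" using ext by blast
    then show ?thesis by (auto simp: el_def[of x])
  qed
  then have *: "(\<lambda>e. e 0 = mk {s (\<lambda>n. e (Suc n)), t (\<lambda>n. e (Suc n))})
    = (\<lambda>e. \<forall>z. z \<epsilon> e 0 \<longleftrightarrow> z = s (\<lambda>n. e (Suc n)) \<or> z = t (\<lambda>n. e (Suc n)))" by simp
  show "definable (\<lambda>e. e 0 = mk {s (\<lambda>n. e (Suc n)), t (\<lambda>n. e (Suc n))})"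
    unfolding *
    by (intro definable_intros definable_term_reindex[OF assms(1)] definable_term_reindex[OF assms(2)])
qed

lemma definable_term_pair:
  assumes "definable_term s" "definable_term t"
  shows "definable_term (\<lambda>e. pair (s e) (t e))"
proof -
  have "definable_term (\<lambda>e. mk {mk {s e, s e}, mk {s e, t e}})"
    by (intro definable_term_mk_pair assms)
  then show ?thesis by (simp add: pair_def)
qed

lemma isset_cart [simp]:
  assumes "isset C" "isset D"
  shows "isset (cart C D)"
proof -
  obtain c d where [simp]: "C = el c" "D = el d" using assms by (auto simp: isset_def)
  obtain u where u: "el u = el c \<union> el d" using isset_Un[OF assms] by (auto simp: isset_def)
  obtain p where p: "el p = {x. el x \<subseteq> el u}" using isset_Pow[of u] by (auto simp: isset_def)
  \<comment> \<open>Kuratowski pairs over \<open>el u\<close> belong to the double power set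
    \<open>q\<close>, from which the product is separated.\<close>
  obtain q where q: "el q = {x. el x \<subseteq> el p}" using isset_Pow[of p] by (auto simp: isset_def)
  have "isset {z \<in> el q. \<exists>x\<in>el c. \<exists>y\<in>el d. z = pair x y}"
    by (intro isset_sep isset_el definable_intros definable_term_pair)
  moreover have "{z \<in> el q. \<exists>x\<in>el c. \<exists>y\<in>el d. z = pair x y} = cart C D"
    by (auto simp: cart_def p q u el_pair)
  ultimately show ?thesis by simp
qed

lemma eq_iff_mem: "x = y \<longleftrightarrow> (\<forall>z. z \<epsilon> x \<longleftrightarrow> z \<epsilon> y)"
  using ext[of x y] by (auto simp: el_def)

lemma mem_cart [simp]: "pair x y \<in> cart C D \<longleftrightarrow> x \<in> C \<and> y \<in> D"
  by (auto simp: cart_def)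

lemma not_mem_self: "\<not> x \<epsilon> x"
proof -
  have "\<exists>y\<in>el (mk {x}). el y \<inter> el (mk {x}) = {}"
    using ZF unfolding ZF_def Foundation_def by (metis el_mk insert_not_empty isset_singleton)
  then have "x \<notin> el x" by simp
  then show ?thesis by (simp add: el_def)
qed

text \<open>The element representing \<open>C\<close> serves as a parameter, so no formula defining
  \<open>C\<close> is required. Membership in \<open>NN\<close> enters formulas in this way.\<close>

lemma definable_isset:
  assumes "isset C" "definable_term t"
  shows "definable (\<lambda>e. t e \<in> C)"
proof -
  obtain c where "C = el c" using assms(1) by (auto simp: isset_def)
  then show ?thesis using definable_in_el[OF assms(2) definable_term_const[of c]] by simp
qed

lemma definable_rel:
  assumes "definable (\<lambda>e. P (e 0) (e 1))"
  shows "definable (\<lambda>e. P (e i) (e j))"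
  by (rule definable_subst2[OF definable_term_var definable_term_var assms])

section \<open>Natural numbers\<close>

lemma el_zero [simp]: "el zero = {}"
  by (simp add: zero_def)

lemma el_suc [simp]: "el (suc x) = insert x (el x)"
  by (simp add: suc_def)

lemma mem_suc [simp]: "y \<epsilon> suc x \<longleftrightarrow> y = x \<or> y \<epsilon> x"
  using el_suc[of x] by (auto simp: el_def)

lemma not_mem_zero [simp]: "\<not> y \<epsilon> zero"
  using el_zero by (auto simp: el_def)

lemma suc_neq_zero [simp]: "suc n \<noteq> zero" "zero \<noteq> suc n"
proof -
  have "el (suc n) \<noteq> el zero" by simp
  then show "suc n \<noteq> zero" "zero \<noteq> suc n" by metis+
qed

lemma definable_term_suc:
  assumes "definable_term t"
  shows "definable_term (\<lambda>e. suc (t e))"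
proof (rule definable_termI)
  have "definable (\<lambda>e. \<forall>z. z \<epsilon> e 0 \<longleftrightarrow> z = t (\<lambda>n. e (Suc n)) \<or> z \<epsilon> t (\<lambda>n. e (Suc n)))"
    by (intro definable_intros definable_term_reindex[OF assms])
  then show "definable (\<lambda>e. e 0 = suc (t (\<lambda>n. e (Suc n))))"
    by (simp add: eq_iff_mem[of _ "suc _"])
qed

lemma is_inductive_iff: "is_inductive w \<longleftrightarrow> zero \<epsilon> w \<and> (\<forall>x\<in>el w. suc x \<epsilon> w)"
proof -
  have "el e = {} \<longleftrightarrow> e = zero" for e using ext[of e zero] by auto
  moreover have "el y = insert x (el x) \<longleftrightarrow> y = suc x" for x y using ext[of y "suc x"] by auto
  ultimately show ?thesis by (simp add: is_inductive_def Bex_def) (simp add: el_def)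
qed

lemma isset_NN: "isset NN"
proof -
  obtain w where w: "is_inductive w" using ZF unfolding ZF_def Infinity_def by blast
  have "isset {n \<in> el w. \<forall>u. zero \<epsilon> u \<and> (\<forall>x\<in>el u. suc x \<epsilon> u) \<longrightarrow> n \<epsilon> u}"
    by (intro isset_sep isset_el definable_intros definable_term_suc)
  moreover have "{n \<in> el w. \<forall>u. zero \<epsilon> u \<and> (\<forall>x\<in>el u. suc x \<epsilon> u) \<longrightarrow> n \<epsilon> u} = NN"
    using w unfolding NN_def by (auto simp: is_inductive_iff el_def)
  ultimately show ?thesis by simp
qed

lemmas definability = definable_intros definable_term_pair definable_term_suc
  definable_isset[OF isset_NN]

lemma zero_NN [simp]: "zero \<in> NN"
  by (simp add: NN_def is_inductive_iff)

lemma suc_NN [simp]: "n \<in> NN \<Longrightarrow> suc n \<in> NN"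
  by (auto simp: NN_def is_inductive_iff el_def)

text \<open>Seen from outside, \<open>NN\<close> may contain nonstandard elements, so induction is
  restricted to definable predicates: Separation then yields the set of all \<open>n\<close> with
  \<open>P n\<close>, which is inductive.\<close>

lemma NN_induct [consumes 1, case_names definable zero suc]:
  assumes "n \<in> NN" "definable (\<lambda>e. P (e 0))" "P zero"
    "\<And>n. n \<in> NN \<Longrightarrow> P n \<Longrightarrow> P (suc n)"
  shows "P n"
proof -
  obtain w where w: "el w = {n \<in> NN. P n}"
    using isset_sep[OF isset_NN assms(2)] by (auto simp: isset_def)
  then have "\<And>x. x \<epsilon> w \<longleftrightarrow> x \<in> NN \<and> P x" by (auto simp: el_def)
  then have "is_inductive w" using assms(3,4) by (simp add: is_inductive_iff w)
  then have "n \<epsilon> w" using assms(1) by (simp add: NN_def)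
  then show ?thesis using w by (auto simp: el_def)
qed

lemma NN_transitive:
  assumes "n \<in> NN" "m \<epsilon> n"
  shows "m \<in> NN" "k \<epsilon> m \<Longrightarrow> k \<epsilon> n"
proof -
  have "\<forall>m. m \<epsilon> n \<longrightarrow> m \<in> NN \<and> (\<forall>k. k \<epsilon> m \<longrightarrow> k \<epsilon> n)"
    using assms(1)
  proof (induction n rule: NN_induct)
    case definable
    show ?case by (intro definability)
  qed auto
  then show "m \<in> NN" "k \<epsilon> m \<Longrightarrow> k \<epsilon> n" using assms(2) by auto
qed

lemma NN_asym: "n \<in> NN \<Longrightarrow> m \<epsilon> n \<Longrightarrow> \<not> n \<epsilon> m"
  using NN_transitive(2) not_mem_self by blast

lemma zero_least: "n \<in> NN \<Longrightarrow> zero = n \<or> zero \<epsilon> n"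
proof (induction n rule: NN_induct)
  case definable
  show ?case by (intro definability)
qed auto

lemma suc_le:
  assumes "m \<in> NN" "n \<epsilon> m"
  shows "suc n = m \<or> suc n \<epsilon> m"
proof -
  have "\<forall>n. n \<epsilon> m \<longrightarrow> suc n = m \<or> suc n \<epsilon> m"
    using assms(1)
  proof (induction m rule: NN_induct)
    case definable
    show ?case by (intro definability)
  qed auto
  then show ?thesis using assms(2) by simp
qed

lemma NN_linear:
  assumes "n \<in> NN" "m \<in> NN"
  shows "m \<epsilon> n \<or> m = n \<or> n \<epsilon> m"
proof -
  have "\<forall>m\<in>NN. m \<epsilon> n \<or> m = n \<or> n \<epsilon> m"
    using assms(1)
  proof (induction n rule: NN_induct)
    case definable
    show ?case by (intro definability)
  next
    case zero
    show ?case using zero_least by auto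
  next
    case (suc n)
    then show ?case using suc_le[of _ n] by auto
  qed
  then show ?thesis using assms(2) by simp
qed

lemma NN_less_trans: "n \<in> NN \<Longrightarrow> k \<epsilon> m \<Longrightarrow> m \<epsilon> n \<Longrightarrow> k \<epsilon> n"
  using NN_transitive(2) by blast

lemma suc_inject: "m \<in> NN \<Longrightarrow> n \<in> NN \<Longrightarrow> suc m = suc n \<longleftrightarrow> m = n"
  using NN_asym mem_suc by metis

lemma NN_cases:
  assumes "n \<in> NN"
  shows "n = zero \<or> (\<exists>m\<in>NN. n = suc m)"
  using assms
proof (induction n rule: NN_induct)
  case definable
  show ?case by (intro definability)
qed auto

text \<open>Foundation gives a member of \<open>C\<close> with no member of \<open>C\<close> below
  it; linearity makes it the least one.\<close>

lemma NN_least: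
  assumes "isset C" "C \<subseteq> NN" "C \<noteq> {}"
  shows "\<exists>m\<in>C. \<forall>k\<in>C. k = m \<or> m \<epsilon> k"
proof -
  obtain c where c: "el c = C" using assms(1) by (auto simp: isset_def)
  then obtain m where "m \<in> C" "el m \<inter> C = {}"
    using ZF assms(3) unfolding ZF_def Foundation_def by blast
  moreover have "k = m \<or> m \<epsilon> k" if "k \<in> C" for k
    using NN_linear[of k m] that calculation assms(2) by (auto simp: el_def)
  ultimately show ?thesis by blast
qed

section \<open>Functions and cardinality\<close>

text \<open>The definability rules do not treat \<open>app\<close>, so inductions and separations
  speak of pairs in \<open>f\<close>. This equivalence translates between the two forms.\<close>

lemma pair_mem_funs: "f \<in> funs C D \<Longrightarrow> pair x y \<epsilon> f \<longleftrightarrow> x \<in> C \<and> y = app f x"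
proof -
  assume "f \<in> funs C D"
  then have f: "el f \<subseteq> cart C D" "\<And>x. x \<in> C \<Longrightarrow> \<exists>!y. pair x y \<epsilon> f" by (simp_all add: funs_def)
  show ?thesis
  proof (cases "x \<in> C")
    case True
    have "pair x (app f x) \<epsilon> f" unfolding app_def by (rule theI', rule f(2), rule True)
    then show ?thesis using f(2)[OF True] True by blast
  next
    case False
    have "pair x y \<in> cart C D" if "pair x y \<epsilon> f"
      by (rule subsetD[OF f(1)]) (simp add: el_def that)
    then show ?thesis using False by auto
  qed
qed

lemma app_mem: "f \<in> funs C D \<Longrightarrow> x \<in> C \<Longrightarrow> app f x \<in> D"
proof -
  assume f: "f \<in> funs C D" and "x \<in> C"
  then have "pair x (app f x) \<in> el f" by (simp add: pair_mem_funs el_def)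
  moreover have "el f \<subseteq> cart C D" using f by (simp add: funs_def)
  ultimately have "pair x (app f x) \<in> cart C D" by (rule rev_subsetD)
  then show ?thesis by simp
qed

text \<open>The graph is separated from \<open>cart C D\<close>; hence \<open>P\<close> may also
  relate \<open>x\<close> to values outside \<open>D\<close>.\<close>

lemma funsI:
  assumes "isset C" "isset D" "definable (\<lambda>e. P (e 0) (e 1))"
    "\<And>x. x \<in> C \<Longrightarrow> \<exists>!y. y \<in> D \<and> P x y"
  obtains f where "f \<in> funs C D" "\<And>x. x \<in> C \<Longrightarrow> P x (app f x)"
proof -
  have "isset {p \<in> cart C D. \<exists>x y. p = pair x y \<and> P x y}"
    by (intro isset_sep isset_cart assms(1,2) definability definable_rel[OF assms(3)])
  then obtain f where f: "el f = {p \<in> cart C D. \<exists>x y. p = pair x y \<and> P x y}"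
    by (auto simp: isset_def)
  have f_iff: "pair x y \<epsilon> f \<longleftrightarrow> x \<in> C \<and> y \<in> D \<and> P x y" for x y
  proof -
    have "pair x y \<epsilon> f \<longleftrightarrow> pair x y \<in> el f" by (simp add: el_def)
    then show ?thesis by (simp add: f)
  qed
  have "f \<in> funs C D"
    unfolding funs_def using assms(4) by (auto simp: f f_iff)
  moreover from this have "P x (app f x)" if "x \<in> C" for x
    using that pair_mem_funs[of f C D x "app f x"] f_iff by simp
  ultimately show ?thesis by (rule that)
qed

lemma equinumerous_iff:
  "equinumerous C D \<longleftrightarrow> (\<exists>f\<in>funs C D. \<forall>y\<in>D. \<exists>!x. pair x y \<epsilon> f)"
proof -
  have "bij_betw (app f) C D \<longleftrightarrow> (\<forall>y\<in>D. \<exists>!x. pair x y \<epsilon> f)" if f: "f \<in> funs C D" for f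
  proof -
    have "app f ` C \<subseteq> D" using app_mem[OF f] by auto
    then show ?thesis unfolding pair_mem_funs[OF f] bij_betw_def inj_on_def by blast
  qed
  then show ?thesis by (auto simp: equinumerous_def)
qed

lemma definable_equinumerous:
  assumes "definable_term s" "definable_term t"
  shows "definable (\<lambda>e. equinumerous (el (s e)) (el (t e)))"
proof (rule definable_subst2[OF assms])
  have "equinumerous (el a) (el b) \<longleftrightarrow> (\<exists>f. (\<forall>z\<in>el f. \<exists>x\<in>el a. \<exists>y\<in>el b. z = pair x y) \<and>
    (\<forall>x\<in>el a. \<exists>!y. pair x y \<epsilon> f) \<and> (\<forall>y\<in>el b. \<exists>!x. pair x y \<epsilon> f))" for a b
  proof -
    have "el f \<subseteq> cart (el a) (el b) \<longleftrightarrow> (\<forall>z\<in>el f. \<exists>x\<in>el a. \<exists>y\<in>el b. z = pair x y)" for f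
      unfolding cart_def by blast
    then show ?thesis unfolding equinumerous_iff funs_def by (simp add: Bex_def[of "Collect _"] conj_assoc)
  qed
  then have *: "(\<lambda>e. equinumerous (el (e 0)) (el (e 1))) = (\<lambda>e. \<exists>f.
    (\<forall>z\<in>el f. \<exists>x\<in>el (e 0). \<exists>y\<in>el (e 1). z = pair x y) \<and>
    (\<forall>x\<in>el (e 0). \<exists>!y. pair x y \<epsilon> f) \<and> (\<forall>y\<in>el (e 1). \<exists>!x. pair x y \<epsilon> f))" by (rule HOL.ext)
  show "definable (\<lambda>e. equinumerous (el (e 0)) (el (e 1)))"
    unfolding * by (intro definability)
qed

lemma definable_fin:
  assumes "definable_term t"
  shows "definable (\<lambda>e. fin (el (t e)))"
  unfolding fin_def
  by (intro definability definable_equinumerous definable_term_reindex[OF assms])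

section \<open>Bounded and unbounded sets of natural numbers\<close>

text \<open>Replaces infinitude for sets of natural numbers. The lemmas that follow identify it both
  with not being \<open>fin\<close> and with being equinumerous to \<open>NN\<close>.\<close>

definition unbounded :: "'a set \<Rightarrow> bool" where
  "unbounded C \<longleftrightarrow> (\<forall>n\<in>NN. \<exists>k\<in>C. n \<epsilon> k)"

lemma NN_max:
  assumes "a \<in> NN" "b \<in> NN"
  obtains c where "c \<in> NN" "\<And>x. x \<epsilon> a \<or> x \<epsilon> b \<Longrightarrow> x \<epsilon> c"
proof -
  consider "a \<epsilon> b" | "a = b" | "b \<epsilon> a" using NN_linear[OF assms(2,1)] by blast
  then show ?thesis
  proof cases
    case 1
    show ?thesis by (rule that[of b]) (use 1 assms NN_less_trans in blast)+
  next
    case 2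
    show ?thesis by (rule that[of b]) (use 2 assms in blast)+
  next
    case 3
    show ?thesis by (rule that[of a]) (use 3 assms NN_less_trans in blast)+
  qed
qed

text \<open>Induction on \<open>n\<close>: the bound is enlarged past the value at \<open>n\<close>,
  if there is one. \<open>P\<close> may be partial so that it can be the inverse of an injection;
  the lemma does the work of the pigeonhole principle.\<close>

lemma image_bounded:
  assumes "n \<in> NN" "definable (\<lambda>e. P (e 0) (e 1))"
    and functional: "\<And>i j k. P i j \<Longrightarrow> P i k \<Longrightarrow> j = k" and NN: "\<And>i j. P i j \<Longrightarrow> j \<in> NN"
  shows "\<exists>m\<in>NN. \<forall>i j. i \<epsilon> n \<and> P i j \<longrightarrow> j \<epsilon> m"
  using assms(1)
proof (induction n rule: NN_induct)
  case definable
  show ?case by (intro definability definable_rel[OF assms(2)])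
next
  case zero
  show ?case by (rule bexI[OF _ zero_NN]) simp
next
  case (suc n)
  then obtain m where m: "m \<in> NN" "\<And>i j. i \<epsilon> n \<Longrightarrow> P i j \<Longrightarrow> j \<epsilon> m" by blast
  show ?case
  proof (cases "\<exists>j. P n j")
    case True
    then obtain j where j: "P n j" ..
    then have "suc j \<in> NN" using NN by simp
    then obtain c where c: "c \<in> NN" "\<And>x. x \<epsilon> m \<or> x \<epsilon> suc j \<Longrightarrow> x \<epsilon> c"
      using NN_max[OF m(1)] by metis
    have "k \<epsilon> c" if "i \<epsilon> suc n" "P i k" for i k
    proof (cases "i = n")
      case True
      then have "k = j" using functional j that(2) by blast
      then show ?thesis by (intro c(2)) simp
    next
      case False
      then show ?thesis using that by (intro c(2) disjI1 m(2)[of i]) simp_all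
    qed
    then show ?thesis using c(1) by blast
  next
    case False
    have "k \<epsilon> m" if "i \<epsilon> suc n" "P i k" for i k
      using that False m(2)[of i k] by auto
    then show ?thesis using m(1) by blast
  qed
qed

lemma fin_bounded:
  assumes "C \<subseteq> NN" "fin C"
  shows "\<not> unbounded C"
proof
  assume unb: "unbounded C"
  obtain n f where n: "n \<in> NN" and f: "f \<in> funs (el n) C" and surj: "\<And>y. y \<in> C \<Longrightarrow> \<exists>!x. pair x y \<epsilon> f"
    using assms(2) unfolding fin_def equinumerous_iff by auto
  have "\<exists>m\<in>NN. \<forall>i j. i \<epsilon> n \<and> pair i j \<epsilon> f \<longrightarrow> j \<epsilon> m"
  proof (rule image_bounded[OF n])
    show "definable (\<lambda>e. pair (e 0) (e 1) \<epsilon> f)" by (intro definability)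
    show "j \<in> NN" if "pair i j \<epsilon> f" for i j
      using that app_mem[OF f, of i] assms(1) by (auto simp: pair_mem_funs[OF f])
  qed (simp add: pair_mem_funs[OF f])
  then obtain m where m: "m \<in> NN" "\<And>i j. i \<epsilon> n \<Longrightarrow> pair i j \<epsilon> f \<Longrightarrow> j \<epsilon> m" by blast
  obtain k where k: "k \<in> C" "m \<epsilon> k" using unb m(1) by (auto simp: unbounded_def)
  obtain x where x: "pair x k \<epsilon> f" using surj[OF k(1)] by blast
  then have "x \<epsilon> n" using pair_mem_funs[OF f] by (simp add: el_def)
  then have "k \<epsilon> m" using m(2) x by blast
  then show False using NN_asym[OF m(1)] k(2) by blast
qed

lemma equinumerous_NN_unbounded:
  assumes "C \<subseteq> NN" "equinumerous NN C"
  shows "unbounded C"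
proof (rule ccontr)
  assume "\<not> unbounded C"
  then obtain n where n: "n \<in> NN" and bound: "\<And>k. k \<in> C \<Longrightarrow> \<not> n \<epsilon> k"
    by (auto simp: unbounded_def)
  obtain f where f: "f \<in> funs NN C" and inj: "\<And>y. y \<in> C \<Longrightarrow> \<exists>!x. pair x y \<epsilon> f"
    using assms(2) unfolding equinumerous_iff by auto
  \<comment> \<open>This concerns the inverse of \<open>f\<close>. All values of \<open>f\<close>
    are below \<open>suc n\<close>, so all indices would be below some \<open>m\<close>, but
    \<open>m\<close> is itself an index.\<close>
  have "\<exists>m\<in>NN. \<forall>i j. i \<epsilon> suc n \<and> pair j i \<epsilon> f \<longrightarrow> j \<epsilon> m"
  proof (rule image_bounded[OF suc_NN[OF n]])
    show "definable (\<lambda>e. pair (e 1) (e 0) \<epsilon> f)" by (intro definability)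
    show "j = k" if "pair j i \<epsilon> f" "pair k i \<epsilon> f" for i j k
    proof -
      have "i \<in> C" using that app_mem[OF f, of j] by (auto simp: pair_mem_funs[OF f])
      then show ?thesis using inj that by blast
    qed
  qed (simp add: pair_mem_funs[OF f])
  then obtain m where m: "m \<in> NN" "\<And>i j. i \<epsilon> suc n \<Longrightarrow> pair j i \<epsilon> f \<Longrightarrow> j \<epsilon> m" by blast
  have "app f m \<in> C" using app_mem[OF f m(1)] .
  then have "app f m \<epsilon> suc n" using bound NN_linear[OF n, of "app f m"] assms(1) by auto
  then have "m \<epsilon> m" using m by (simp add: pair_mem_funs[OF f])
  then show False using not_mem_self by blast
qed

lemma fin_empty: "fin {}"
proof -
  have "zero \<in> funs {} {}" by (simp add: funs_def)
  then have "equinumerous (el zero) {}" by (auto simp: equinumerous_iff)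
  then show ?thesis unfolding fin_def by (rule bexI[OF _ zero_NN])
qed

text \<open>A bijection on \<open>n\<close> is extended by sending \<open>n\<close> to
  \<open>a\<close>. This works because \<open>suc n\<close> adds to \<open>n\<close> the single
  element \<open>n\<close>, which is new by Foundation.\<close>

lemma fin_insert:
  assumes "fin C"
  shows "fin (insert a C)"
proof (cases "a \<in> C")
  case True
  then show ?thesis using assms by (simp add: insert_absorb)
next
  case False
  obtain n f where n: "n \<in> NN" and f: "f \<in> funs (el n) C" and bij: "\<And>y. y \<in> C \<Longrightarrow> \<exists>!x. pair x y \<epsilon> f"
    using assms unfolding fin_def equinumerous_iff by auto
  have sub: "el f \<subseteq> cart (el n) C" and fn: "\<And>x. x \<in> el n \<Longrightarrow> \<exists>!y. pair x y \<epsilon> f"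
    using f by (simp_all add: funs_def)
  have nn: "n \<notin> el n" using not_mem_self by (simp add: el_def)
  define g where "g = mk (insert (pair n a) (el f))"
  have el_g: "el g = insert (pair n a) (el f)" by (simp add: g_def)
  have g_iff: "pair x y \<epsilon> g \<longleftrightarrow> x = n \<and> y = a \<or> pair x y \<epsilon> f" for x y
  proof -
    have "pair x y \<epsilon> g \<longleftrightarrow> pair x y \<in> el g" by (simp add: el_def)
    then show ?thesis unfolding el_g by (auto simp: el_def)
  qed
  have f_mem: "x \<in> el n" "y \<in> C" if "pair x y \<epsilon> f" for x y
    using that app_mem[OF f] pair_mem_funs[OF f] by auto
  have "cart (el n) C \<subseteq> cart (el (suc n)) (insert a C)" by (auto simp: cart_def)
  then have "el g \<subseteq> cart (el (suc n)) (insert a C)"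
    using sub unfolding el_g by (simp add: order_trans)
  moreover have "\<exists>!y. pair x y \<epsilon> g" if "x \<in> el (suc n)" for x
  proof (cases "x = n")
    case True
    then show ?thesis using f_mem(1) nn unfolding g_iff by blast
  next
    case False
    then show ?thesis using fn that unfolding g_iff by simp
  qed
  moreover have "\<exists>!x. pair x y \<epsilon> g" if "y \<in> insert a C" for y
  proof (cases "y = a")
    case True
    then show ?thesis using f_mem(2) \<open>a \<notin> C\<close> unfolding g_iff by blast
  next
    case False
    then show ?thesis using bij that unfolding g_iff by simp
  qed
  ultimately have "equinumerous (el (suc n)) (insert a C)"
    unfolding equinumerous_iff by (intro bexI[of _ g]) (simp_all add: funs_def)
  then show ?thesis unfolding fin_def by (rule bexI[OF _ suc_NN[OF n]])
qed

lemma fin_subset_NN: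
  assumes "n \<in> NN" "el c \<subseteq> el n"
  shows "fin (el c)"
proof -
  \<comment> \<open>The induction concerns the part of \<open>c\<close> below \<open>n\<close>,
    described through its members to keep the predicate definable. For the given \<open>n\<close> it
    is all of \<open>c\<close>.\<close>
  have "\<exists>s. (\<forall>z. z \<epsilon> s \<longleftrightarrow> z \<epsilon> c \<and> z \<epsilon> n) \<and> fin (el s)"
    using assms(1)
  proof (induction n rule: NN_induct)
    case definable
    show ?case by (intro definability definable_fin)
  next
    case zero
    show ?case using fin_empty by (intro exI[of _ zero]) simp
  next
    case (suc n)
    then obtain s where s: "\<And>z. z \<epsilon> s \<longleftrightarrow> z \<epsilon> c \<and> z \<epsilon> n" "fin (el s)" by blast
    show ?case
    proof (cases "n \<epsilon> c")
      case True
      have *: "z \<epsilon> mk (insert n (el s)) \<longleftrightarrow> z = n \<or> z \<epsilon> s" for z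
        by (simp add: mem_mk) (simp add: el_def)
      show ?thesis
        by (intro exI[of _ "mk (insert n (el s))"]) (use True s fin_insert in \<open>auto simp: *\<close>)
    next
      case False
      then show ?thesis using s by (intro exI[of _ s]) auto
    qed
  qed
  then obtain s where s: "\<And>z. z \<epsilon> s \<longleftrightarrow> z \<epsilon> c \<and> z \<epsilon> n" "fin (el s)" by blast
  have "s = c" using assms(2) s(1) by (auto simp: eq_iff_mem el_def)
  then show ?thesis using s(2) by simp
qed

lemma bounded_fin:
  assumes "isset C" "C \<subseteq> NN" "\<not> unbounded C"
  shows "fin C"
proof -
  obtain c where c: "C = el c" using assms(1) by (auto simp: isset_def)
  obtain n where n: "n \<in> NN" "\<And>k. k \<in> C \<Longrightarrow> \<not> n \<epsilon> k" using assms(3) by (auto simp: unbounded_def)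
  have "k \<epsilon> suc n" if "k \<in> C" for k
    using n(2)[OF that] NN_linear[OF n(1), of k] that assms(2) by auto
  then have "el c \<subseteq> el (suc n)" unfolding c el_def[of "suc n"] by blast
  then show ?thesis unfolding c by (rule fin_subset_NN[OF suc_NN[OF n(1)]])
qed

section \<open>Recursion and enumeration\<close>

text \<open>The function is the least set \<open>g\<close> of pairs closed under the recursion clauses: a superfluous
  value could be removed from \<open>g\<close>.\<close>

lemma recursion:
  assumes X: "isset X" and h: "h \<in> funs X X" and m: "m \<in> X"
  obtains g where "g \<in> funs NN X" "app g zero = m"
    "\<And>n. n \<in> NN \<Longrightarrow> app g (suc n) = app h (app g n)"
proof -
  define closed where "closed R \<longleftrightarrow> pair zero m \<epsilon> R \<and>
    (\<forall>n\<in>NN. \<forall>k l. pair n k \<epsilon> R \<and> pair k l \<epsilon> h \<longrightarrow> pair (suc n) l \<epsilon> R)" for R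
  have "isset {p \<in> cart NN X. \<forall>R. closed R \<longrightarrow> p \<epsilon> R}"
    unfolding closed_def by (intro isset_sep isset_cart isset_NN X definability)
  then obtain g where el_g: "el g = {p \<in> cart NN X. \<forall>R. closed R \<longrightarrow> p \<epsilon> R}"
    by (auto simp: isset_def)
  have g_iff: "pair n k \<epsilon> g \<longleftrightarrow> n \<in> NN \<and> k \<in> X \<and> (\<forall>R. closed R \<longrightarrow> pair n k \<epsilon> R)" for n k
  proof -
    have "pair n k \<epsilon> g \<longleftrightarrow> pair n k \<in> el g" by (simp add: el_def)
    then show ?thesis unfolding el_g by simp
  qed
  have h_iff: "pair k l \<epsilon> h \<longleftrightarrow> k \<in> X \<and> l = app h k" for k l
    by (rule pair_mem_funs[OF h])
  have g_zero: "pair zero m \<epsilon> g" using m by (simp add: g_iff closed_def)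
  have g_suc: "pair (suc n) (app h k) \<epsilon> g" if "pair n k \<epsilon> g" for n k
    using that app_mem[OF h] unfolding g_iff closed_def h_iff by simp
  have minimal: "\<exists>n'\<in>NN. \<exists>k'. pair n' k' \<epsilon> g \<and> n = suc n' \<and> k = app h k'"
    if nk: "pair n k \<epsilon> g" and neq: "n \<noteq> zero \<or> k \<noteq> m" for n k
  proof (rule ccontr)
    assume *: "\<not> ?thesis"
    have R_set: "isset (el g - {pair n k})" by (rule isset_Diff_singleton) simp
    have R_iff: "p \<epsilon> mk (el g - {pair n k}) \<longleftrightarrow> p \<epsilon> g \<and> p \<noteq> pair n k" for p
      unfolding mem_mk[OF R_set] by (simp add: el_def)
    have "pair (suc n') (app h k') \<epsilon> mk (el g - {pair n k})" if "pair n' k' \<epsilon> g" for n' k'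
    proof -
      have "n' \<in> NN" using that by (simp add: g_iff)
      then have "\<not> (n = suc n' \<and> k = app h k')" using * that by blast
      then show ?thesis unfolding R_iff using g_suc[OF that] by auto
    qed
    then have "closed (mk (el g - {pair n k}))"
      unfolding closed_def using g_zero neq by (auto simp: R_iff h_iff)
    then have "pair n k \<epsilon> mk (el g - {pair n k})" using nk by (simp add: g_iff)
    then show False by (simp add: R_iff)
  qed
  have unique: "\<exists>!k. pair n k \<epsilon> g" if "n \<in> NN" for n
    using that
  proof (induction n rule: NN_induct)
    case definable
    show ?case by (intro definability)
  next
    case zero
    have "k = m" if "pair zero k \<epsilon> g" for k using minimal[OF that] by auto
    then show ?case using g_zero by blast
  next
    case (suc n)
    then obtain k where k: "pair n k \<epsilon> g" and uk: "\<And>k'. pair n k' \<epsilon> g \<Longrightarrow> k' = k" by blast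
    have "l = app h k" if l: "pair (suc n) l \<epsilon> g" for l
    proof -
      obtain n' k' where n': "n' \<in> NN" "pair n' k' \<epsilon> g" "suc n = suc n'" "l = app h k'"
        using minimal[OF l] by auto
      then have "n' = n" using suc_inject suc.hyps by blast
      then show ?thesis using n' uk by blast
    qed
    then show ?case using g_suc[OF k] by blast
  qed
  have g: "g \<in> funs NN X" using unique by (auto simp: funs_def el_g)
  show ?thesis
  proof (rule that[OF g])
    show "app g zero = m" using g_zero pair_mem_funs[OF g] by simp
    show "app g (suc n) = app h (app g n)" if "n \<in> NN" for n
      using g_suc[of n "app g n"] that pair_mem_funs[OF g] by simp
  qed
qed

section \<open>Increasing enumeration of sets of natural numbers\<close>

text \<open>\<open>k\<close> need not belong to \<open>C\<close>: with the \<open>m\<close>-th set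
  of the sequence as \<open>C\<close>, this relation says that \<open>j\<close> is
  \<open>a(m,k)\<close>.\<close>

definition next_in :: "'a set \<Rightarrow> 'a \<Rightarrow> 'a \<Rightarrow> bool" where
  "next_in C k j \<longleftrightarrow> j \<in> C \<and> k \<epsilon> j \<and> (\<forall>i\<in>C. k \<epsilon> i \<longrightarrow> i = j \<or> j \<epsilon> i)"

lemma next_in_unique:
  assumes "C \<subseteq> NN" "next_in C k i" "next_in C k j"
  shows "i = j"
proof -
  have "i = j \<or> j \<epsilon> i" "j = i \<or> i \<epsilon> j" "i \<in> NN" using assms by (auto simp: next_in_def)
  then show ?thesis using NN_asym by blast
qed

lemma next_in_exists:
  assumes "isset C" "C \<subseteq> NN" "unbounded C" "k \<in> NN"
  shows "\<exists>j. next_in C k j"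
proof -
  have "isset {j \<in> C. k \<epsilon> j}" by (intro isset_sep assms definability)
  moreover have "{j \<in> C. k \<epsilon> j} \<noteq> {}" using assms(3,4) by (auto simp: unbounded_def)
  ultimately obtain j where "j \<in> {j \<in> C. k \<epsilon> j}" "\<forall>i\<in>{j \<in> C. k \<epsilon> j}. i = j \<or> j \<epsilon> i"
    using NN_least[of "{j \<in> C. k \<epsilon> j}"] assms(2) by auto
  then show ?thesis by (auto simp: next_in_def)
qed

lemma unbounded_nonempty: "unbounded C \<Longrightarrow> C \<noteq> {}"
  unfolding unbounded_def using zero_NN by blast

lemma increasing:
  assumes f: "f \<in> funs NN D" and step: "\<And>n. n \<in> NN \<Longrightarrow> app f n \<epsilon> app f (suc n)" and D: "D \<subseteq> NN"
    and n: "n \<in> NN" "i \<epsilon> n"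
  shows "app f i \<epsilon> app f n"
proof -
  have "\<forall>i. i \<epsilon> n \<longrightarrow> (\<exists>a b. pair i a \<epsilon> f \<and> pair n b \<epsilon> f \<and> a \<epsilon> b)"
    using n(1)
  proof (induction n rule: NN_induct)
    case definable
    show ?case by (intro definability)
  next
    case (suc n)
    show ?case
    proof (intro allI impI)
      fix i assume i: "i \<epsilon> suc n"
      have "i \<in> NN \<and> (i = n \<or> app f i \<epsilon> app f n)"
        using i suc NN_transitive(1)[OF suc_NN[OF suc.hyps] i] by (auto simp: pair_mem_funs[OF f])
      moreover have "app f (suc n) \<in> NN" using app_mem[OF f suc_NN[OF suc.hyps]] D by blast
      ultimately have "i \<in> NN \<and> app f i \<epsilon> app f (suc n)"
        using step[OF suc.hyps] NN_less_trans by blast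
      then show "\<exists>a b. pair i a \<epsilon> f \<and> pair (suc n) b \<epsilon> f \<and> a \<epsilon> b"
        using suc.hyps by (simp add: pair_mem_funs[OF f])
    qed
  qed simp
  then show ?thesis using n(2) by (auto simp: pair_mem_funs[OF f])
qed

lemma le_app_increasing:
  assumes f: "f \<in> funs NN D" and step: "\<And>n. n \<in> NN \<Longrightarrow> app f n \<epsilon> app f (suc n)" and D: "D \<subseteq> NN"
    and n: "n \<in> NN"
  shows "n = app f n \<or> n \<epsilon> app f n"
proof -
  have "\<exists>a. pair n a \<epsilon> f \<and> (n = a \<or> n \<epsilon> a)"
    using n
  proof (induction n rule: NN_induct)
    case definable
    show ?case by (intro definability)
  next
    case zero
    have "app f zero \<in> NN" using app_mem[OF f zero_NN] D by blast
    then show ?case using zero_least by (auto simp: pair_mem_funs[OF f])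
  next
    case (suc n)
    have "app f (suc n) \<in> NN" using app_mem[OF f suc_NN[OF suc.hyps]] D by blast
    moreover have "n = app f n \<or> n \<epsilon> app f n" using suc.IH by (simp add: pair_mem_funs[OF f])
    ultimately have "n \<epsilon> app f (suc n)" using step[OF suc.hyps] NN_less_trans by metis
    then show ?case using suc_le \<open>app f (suc n) \<in> NN\<close> suc.hyps by (simp add: pair_mem_funs[OF f])
  qed
  then show ?thesis by (auto simp: pair_mem_funs[OF f])
qed

lemma definable_next_in:
  assumes "isset C"
  shows "definable (\<lambda>e. next_in C (e i) (e j))"
  unfolding next_in_def by (intro definability definable_isset assms)

lemma next_function:
  assumes "isset C" "C \<subseteq> NN" "unbounded C"
  obtains h where "h \<in> funs C C" "\<And>k. k \<in> C \<Longrightarrow> next_in C k (app h k)"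
proof (rule funsI[OF assms(1,1), of "next_in C"])
  show "definable (\<lambda>e. next_in C (e 0) (e 1))" by (rule definable_next_in[OF assms(1)])
  show "\<exists>!j. j \<in> C \<and> next_in C k j" if "k \<in> C" for k
  proof -
    have "\<exists>j. next_in C k j" using next_in_exists[OF assms] that assms(2) by blast
    moreover have "j \<in> C" if "next_in C k j" for j using that by (simp add: next_in_def)
    ultimately show ?thesis using next_in_unique[OF assms(2)] by blast
  qed
qed (rule that)

text \<open>Iterating the successor operation of \<open>C\<close> from its least element enumerates
  \<open>C\<close> increasingly. An element \<open>k\<close> is reached at the least
  \<open>n\<close> for which \<open>app f n\<close> is not below \<open>k\<close>.\<close>

lemma unbounded_equinumerous_NN:
  assumes C: "isset C" "C \<subseteq> NN" "unbounded C"
  shows "equinumerous NN C"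
proof -
  obtain h where h: "h \<in> funs C C" "\<And>k. k \<in> C \<Longrightarrow> next_in C k (app h k)"
    using next_function[OF C] by blast
  obtain m where m: "m \<in> C" "\<And>k. k \<in> C \<Longrightarrow> k = m \<or> m \<epsilon> k"
    using NN_least[OF C(1,2) unbounded_nonempty[OF C(3)]] by blast
  obtain f where f: "f \<in> funs NN C" "app f zero = m"
    and f_suc: "\<And>n. n \<in> NN \<Longrightarrow> app f (suc n) = app h (app f n)"
    using recursion[OF C(1) h(1) m(1)] by blast
  have f_next: "next_in C (app f n) (app f (suc n))" if "n \<in> NN" for n
    unfolding f_suc[OF that] by (rule h(2)[OF app_mem[OF f(1) that]])
  then have step: "app f n \<epsilon> app f (suc n)" if "n \<in> NN" for n
    using that by (simp add: next_in_def)
  have surj: "\<exists>n\<in>NN. app f n = k" if k: "k \<in> C" for k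
  proof -
    have kN: "k \<in> NN" using k C(2) by blast
    have "isset {n \<in> NN. \<exists>a. pair n a \<epsilon> f \<and> \<not> a \<epsilon> k}"
      by (intro isset_sep isset_NN definability)
    moreover have "{n \<in> NN. \<exists>a. pair n a \<epsilon> f \<and> \<not> a \<epsilon> k} = {n \<in> NN. \<not> app f n \<epsilon> k}"
      by (auto simp: pair_mem_funs[OF f(1)])
    ultimately have "isset {n \<in> NN. \<not> app f n \<epsilon> k}" by simp
    \<comment> \<open>Such an \<open>n\<close> exists, \<open>k\<close> itself being one: a strictly
      increasing \<open>f\<close> satisfies \<open>k \<le> f(k)\<close>.\<close>
    moreover have "k \<in> {n \<in> NN. \<not> app f n \<epsilon> k}"
      using le_app_increasing[OF f(1) step C(2) kN] NN_asym[OF kN] kN not_mem_self by auto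
    ultimately obtain n where n: "n \<in> NN" "\<not> app f n \<epsilon> k"
      and least: "\<And>i. i \<in> NN \<Longrightarrow> \<not> app f i \<epsilon> k \<Longrightarrow> i = n \<or> n \<epsilon> i"
      using NN_least[of "{n \<in> NN. \<not> app f n \<epsilon> k}"] by blast
    show ?thesis
    proof (cases "n = zero")
      case True
      then show ?thesis using m(2)[OF k] n f(2) by auto
    next
      case False
      then obtain i where i: "i \<in> NN" "n = suc i" using NN_cases[OF n(1)] by blast
      have "app f i \<epsilon> k"
        using least[OF i(1)] i(2) NN_asym[OF n(1), of i] not_mem_self[of i] mem_suc[of i i] by metis
      \<comment> \<open>\<open>app f n\<close> is the next element of \<open>C\<close> after
        \<open>app f i\<close>, which is below \<open>k\<close>, so it cannot exceed
        \<open>k\<close>.\<close>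
      then have "k = app f n \<or> app f n \<epsilon> k" using f_next[OF i(1)] k by (simp add: next_in_def i(2))
      then show ?thesis using n by blast
    qed
  qed
  have inj: "i = j" if "i \<in> NN" "j \<in> NN" "app f i = app f j" for i j
    using NN_linear[OF that(1,2)] increasing[OF f(1) step C(2)] that not_mem_self by metis
  show ?thesis
    unfolding equinumerous_iff
  proof (intro bexI[OF _ f(1)] ballI)
    fix k assume "k \<in> C"
    then obtain n where "n \<in> NN" "app f n = k" using surj by blast
    then show "\<exists>!x. pair x k \<epsilon> f" using inj by (auto simp: pair_mem_funs[OF f(1)])
  qed
qed

lemma inf_subsets_iff:
  assumes "C \<subseteq> NN"
  shows "x \<in> inf_subsets C \<longleftrightarrow> el x \<subseteq> C \<and> unbounded (el x)"
  using assms equinumerous_NN_unbounded[of "el x"] unbounded_equinumerous_NN[of "el x"]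
  by (auto simp: inf_subsets_def)

lemma unbounded_if_no_max:
  assumes D: "isset D" "D \<subseteq> NN" "D \<noteq> {}" and no_max: "\<And>k. k \<in> D \<Longrightarrow> \<exists>l\<in>D. k \<epsilon> l"
  shows "unbounded D"
  unfolding unbounded_def
proof
  fix n assume "n \<in> NN"
  then show "\<exists>k\<in>D. n \<epsilon> k"
  proof (induction n rule: NN_induct)
    case definable
    show ?case by (intro definability definable_isset[OF D(1)])
  next
    case zero
    obtain k l where "l \<in> D" "k \<epsilon> l" using no_max D(3) by blast
    then have "l \<in> NN" "l \<noteq> zero" using D(2) by auto
    then have "zero \<epsilon> l" using zero_least by metis
    then show ?case using \<open>l \<in> D\<close> by blast
  next
    case (suc n)
    then obtain k where k: "k \<in> D" "n \<epsilon> k" by blast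
    obtain l where l: "l \<in> D" "k \<epsilon> l" using no_max[OF k(1)] by blast
    have "suc n = k \<or> suc n \<epsilon> k" using suc_le k D(2) by blast
    then have "suc n \<epsilon> l" using l D(2) NN_less_trans by blast
    then show ?case using l(1) by blast
  qed
qed

lemma unbounded_mono: "unbounded C \<Longrightarrow> C \<subseteq> D \<Longrightarrow> unbounded D"
  unfolding unbounded_def by blast

section \<open>Almost disjoint families\<close>

lemma almost_disjoint_eqI:
  assumes "almost_disjoint A" "x \<in> el A" "y \<in> el A" "unbounded (el x \<inter> el y)"
  shows "x = y"
proof (rule ccontr)
  assume "x \<noteq> y"
  then have "fin (el x \<inter> el y)" using assms(1-3) unfolding almost_disjoint_def by blast
  moreover have "el x \<inter> el y \<subseteq> NN"
    using assms(1,2) unfolding almost_disjoint_def inf_subsets_def by blast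
  ultimately show False using fin_bounded assms(4) by blast
qed

text \<open>Otherwise \<open>X\<close> could be added to the family, contradicting
  maximality.\<close>

lemma mad_meets:
  assumes "mad A" "isset X" "X \<subseteq> NN" "unbounded X"
  shows "\<exists>y\<in>el A. unbounded (X \<inter> el y)"
proof (rule ccontr)
  assume *: "\<not> ?thesis"
  obtain x where x: "el x = X" using assms(2) by (auto simp: isset_def)
  have x_inf: "x \<in> inf_subsets NN" using assms(3,4) inf_subsets_iff[of NN] by (simp add: x)
  have "x \<notin> el A" using * assms(4) x by auto
  moreover have A: "almost_disjoint A" using assms(1) by (simp add: mad_def)
  moreover have "fin (el x \<inter> el y)" "fin (el y \<inter> el x)" if "y \<in> el A" for y
  proof -
    show "fin (el x \<inter> el y)"
      by (rule bounded_fin[OF isset_Int]) (use * that x assms(3) in auto)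
    then show "fin (el y \<inter> el x)" by (simp add: Int_commute)
  qed
  ultimately have "almost_disjoint (mk (insert x (el A)))"
    using x_inf unfolding almost_disjoint_def by simp
  moreover have "el A \<subset> el (mk (insert x (el A)))" using \<open>x \<notin> el A\<close> by auto
  ultimately show False using assms(1) unfolding mad_def by blast
qed

text \<open>DC yields a chain of finite subsets of \<open>A\<close>, each obtained from the
  preceding one by adding one new member; \<open>g n\<close> is the member added at step
  \<open>n\<close>.\<close>

lemma infinite_sequence:
  assumes DC and "\<not> fin (el A)"
  obtains g where "g \<in> funs NN (el A)" "inj_on (app g) NN"
proof -
  have "isset {s \<in> {s. el s \<subseteq> el A}. fin (el s)}"
    by (intro isset_sep isset_Pow definability definable_fin)
  then obtain X where X: "el X = {s. el s \<subseteq> el A \<and> fin (el s)}" by (auto simp: isset_def)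
  define adds where "adds s t \<longleftrightarrow> (\<exists>a. a \<epsilon> A \<and> \<not> a \<epsilon> s \<and> (\<forall>z. z \<epsilon> t \<longleftrightarrow> z = a \<or> z \<epsilon> s))" for s t
  have "isset {p \<in> cart (el X) (el X). \<exists>s t. p = pair s t \<and> adds s t}"
    unfolding adds_def by (intro isset_sep isset_cart isset_el definability)
  then obtain R where R: "el R = {p \<in> cart (el X) (el X). \<exists>s t. p = pair s t \<and> adds s t}"
    by (auto simp: isset_def)
  have R_iff: "pair s t \<epsilon> R \<longleftrightarrow> s \<in> el X \<and> t \<in> el X \<and> adds s t" for s t
  proof -
    have "pair s t \<epsilon> R \<longleftrightarrow> pair s t \<in> el R" by (simp add: el_def)
    then show ?thesis unfolding R by simp
  qed
  have "zero \<in> el X" using fin_empty by (simp add: X)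
  moreover have "\<exists>t\<in>el X. pair s t \<epsilon> R" if s: "s \<in> el X" for s
  proof -
    have "el s \<noteq> el A" using s assms(2) by (auto simp: X)
    then obtain a where a: "a \<in> el A" "a \<notin> el s" using s by (auto simp: X)
    define t where "t = mk (insert a (el s))"
    have t: "el t = insert a (el s)" by (simp add: t_def)
    then have "t \<in> el X" using s a fin_insert by (simp add: X)
    moreover have "adds s t"
      unfolding adds_def using a t by (intro exI[of _ a]) (auto simp: el_def set_eq_iff)
    ultimately show ?thesis using s R_iff by blast
  qed
  moreover have "el R \<subseteq> cart (el X) (el X)" by (auto simp: R)
  ultimately have "\<exists>f\<in>funs NN (el X). \<forall>n\<in>NN. pair (app f n) (app f (suc n)) \<epsilon> R"
    using assms(1) unfolding DC_def by blast
  then obtain f where f: "f \<in> funs NN (el X)"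
    and f_step: "\<And>n. n \<in> NN \<Longrightarrow> adds (app f n) (app f (suc n))" using R_iff by blast
  \<comment> \<open>The member added at step \<open>i\<close> remains in all later sets, whereas the
    one added at step \<open>n\<close> is new. This makes \<open>g\<close> injective.\<close>
  have mono: "el (app f (suc i)) \<subseteq> el (app f n)" if "n \<in> NN" "i \<epsilon> n" for n i
  proof -
    have "\<forall>i. i \<epsilon> n \<longrightarrow> (\<exists>s t. pair (suc i) s \<epsilon> f \<and> pair n t \<epsilon> f \<and> el s \<subseteq> el t)"
      using that(1)
    proof (induction n rule: NN_induct)
      case definable
      show ?case by (intro definability)
    next
      case (suc n)
      show ?case
      proof (intro allI impI)
        fix i assume i: "i \<epsilon> suc n"
        have "el (app f n) \<subseteq> el (app f (suc n))"
          using f_step[OF suc.hyps] unfolding adds_def el_def by blast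
        moreover have "i \<in> NN" using NN_transitive(1)[OF suc_NN[OF suc.hyps] i] .
        moreover have "i = n \<or> el (app f (suc i)) \<subseteq> el (app f n)"
          using i suc.IH by (auto simp: pair_mem_funs[OF f])
        ultimately have "el (app f (suc i)) \<subseteq> el (app f (suc n))" by auto
        then show "\<exists>s t. pair (suc i) s \<epsilon> f \<and> pair (suc n) t \<epsilon> f \<and> el s \<subseteq> el t"
          using \<open>i \<in> NN\<close> suc.hyps by (simp add: pair_mem_funs[OF f])
      qed
    qed simp
    then show ?thesis using that(2) by (auto simp: pair_mem_funs[OF f])
  qed
  obtain g where g: "g \<in> funs NN (el A)"
    and g': "\<And>n. n \<in> NN \<Longrightarrow> \<exists>s t. pair n s \<epsilon> f \<and> pair (suc n) t \<epsilon> f \<and> app g n \<epsilon> t \<and> \<not> app g n \<epsilon> s"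
  proof (rule funsI[OF isset_NN isset_el[of A],
        of "\<lambda>n a. \<exists>s t. pair n s \<epsilon> f \<and> pair (suc n) t \<epsilon> f \<and> a \<epsilon> t \<and> \<not> a \<epsilon> s"])
    show "definable (\<lambda>e. \<exists>s t. pair (e 0) s \<epsilon> f \<and> pair (suc (e 0)) t \<epsilon> f \<and> e 1 \<epsilon> t \<and> \<not> e 1 \<epsilon> s)"
      by (intro definability)
    show "\<exists>!a. a \<in> el A \<and> (\<exists>s t. pair n s \<epsilon> f \<and> pair (suc n) t \<epsilon> f \<and> a \<epsilon> t \<and> \<not> a \<epsilon> s)" if n: "n \<in> NN" for n
    proof -
      obtain a where "a \<epsilon> A" "\<not> a \<epsilon> app f n" "\<And>z. z \<epsilon> app f (suc n) \<longleftrightarrow> z = a \<or> z \<epsilon> app f n"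
        using f_step[OF n] by (auto simp: adds_def)
      then have "\<exists>!a. a \<in> el A \<and> a \<epsilon> app f (suc n) \<and> \<not> a \<epsilon> app f n"
        by (intro ex1I[of _ a]) (auto simp: el_def)
      then show ?thesis using n by (simp add: pair_mem_funs[OF f])
    qed
  qed (rule that)
  have g_mem: "app g n \<in> el (app f (suc n))" "app g n \<notin> el (app f n)" if "n \<in> NN" for n
    using g'[OF that] by (auto simp: pair_mem_funs[OF f] el_def)
  have "app g i \<noteq> app g n" if "n \<in> NN" "i \<epsilon> n" for i n
    using mono[OF that] g_mem(1)[OF NN_transitive(1)[OF that]] g_mem(2)[OF that(1)] by auto
  then have "inj_on (app g) NN" using NN_linear by (metis inj_onI)
  then show ?thesis using g that by blast
qed

end

section \<open>Mad families and the Ramsey property\<close>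

locale mad_sequence = zf_structure mem for mem :: "'a \<Rightarrow> 'a \<Rightarrow> bool" (infix "\<epsilon>" 50) +
  fixes A g
  assumes mad: "mad A" and g: "g \<in> funs NN (el A)" and inj: "inj_on (app g) NN"
begin

text \<open>Enumerate \<open>z\<close> increasingly as \<open>z\<^sub>0, z\<^sub>1, \<dots>\<close>, and let \<open>a(m,n)\<close> be the least element above \<open>n\<close> of the
  \<open>m\<close>-th set of the sequence \<open>g\<close>. The conditions say that \<open>E \<inter> z\<close> is the set of the \<open>z\<^bsub>2i\<^esub>\<close>, and that all
  \<open>a(z\<^bsub>2i\<^esub>, z\<^bsub>2i+1\<^esub>)\<close> are in \<open>y\<close>.\<close>

definition captures :: "'a \<Rightarrow> 'a \<Rightarrow> 'a \<Rightarrow> bool" where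
  "captures y z E \<longleftrightarrow> (\<forall>k\<in>el z. (\<forall>i\<in>el z. i = k \<or> k \<epsilon> i) \<longrightarrow> k \<epsilon> E) \<and>
    (\<forall>k\<in>el E. \<exists>j l w v. next_in (el z) k j \<and> \<not> j \<epsilon> E \<and> next_in (el z) j l \<and> l \<epsilon> E \<and>
       pair k w \<epsilon> g \<and> next_in (el w) j v \<and> v \<epsilon> y)"

text \<open>The set \<open>S\<close> of the proof idea. Quantifying over \<open>E\<close> expresses
  the parity of positions in \<open>z\<close> without enumerating \<open>z\<close>.\<close>

definition captured :: "'a set" where
  "captured = {z \<in> inf_subsets NN. \<exists>y\<in>el A. \<exists>E. captures y z E}"

lemma isset_captured: "isset captured"
proof -
  obtain N where N: "el N = NN" using isset_NN by (auto simp: isset_def)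
  have "isset {z \<in> {z. el z \<subseteq> el N}. unbounded (el z) \<and> (\<exists>y\<in>el A. \<exists>E. captures y z E)}"
    unfolding unbounded_def captures_def next_in_def by (intro isset_sep isset_Pow definability)
  moreover have "{z \<in> {z. el z \<subseteq> el N}. unbounded (el z) \<and> (\<exists>y\<in>el A. \<exists>E. captures y z E)} = captured"
    unfolding captured_def by (simp add: inf_subsets_iff N conj_assoc)
  ultimately show ?thesis by simp
qed

lemma almost_disjoint: "almost_disjoint A"
  using mad by (simp add: mad_def)

lemma member_NN: "y \<in> el A \<Longrightarrow> el y \<subseteq> NN" and member_unbounded: "y \<in> el A \<Longrightarrow> unbounded (el y)"
proof -
  assume "y \<in> el A"
  then have "y \<in> inf_subsets NN" using almost_disjoint unfolding almost_disjoint_def by blast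
  then show "el y \<subseteq> NN" "unbounded (el y)" by (simp_all add: inf_subsets_iff)
qed

lemma app_g_mem: "k \<in> NN \<Longrightarrow> app g k \<in> el A"
  by (rule app_mem[OF g])

text \<open>Excludes homogeneity by disjointness from \<open>captured\<close>: \<open>B\<close> is
  grouped into consecutive pairs, and maximality picks one \<open>y\<close> that serves infinitely
  many of them.\<close>

lemma exists_captured:
  assumes "B \<in> inf_subsets NN"
  shows "inf_subsets (el B) \<inter> captured \<noteq> {}"
proof -
  have B: "el B \<subseteq> NN" "unbounded (el B)" using assms by (simp_all add: inf_subsets_iff)
  obtain h where h: "h \<in> funs (el B) (el B)" and h_next: "\<And>k. k \<in> el B \<Longrightarrow> next_in (el B) k (app h k)"
    using next_function[OF isset_el B] by blast
  have h_mem: "app h k \<in> el B" if "k \<in> el B" for k using app_mem[OF h that] .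
  have h_less: "k \<epsilon> app h k" if "k \<in> el B" for k using h_next[OF that] by (simp add: next_in_def)
  have h_least: "i = app h k \<or> app h k \<epsilon> i" if "k \<in> el B" "i \<in> el B" "k \<epsilon> i" for k i
    using h_next[OF that(1)] that by (simp add: next_in_def)
  have next_iff: "next_in (el B) k j \<longleftrightarrow> j = app h k" if "k \<in> el B" for k j
    using next_in_unique[OF B(1) h_next[OF that]] h_next[OF that] by blast
  obtain h2 where h2: "h2 \<in> funs (el B) (el B)"
    and h2': "\<And>k. k \<in> el B \<Longrightarrow> \<exists>j. pair k j \<epsilon> h \<and> pair j (app h2 k) \<epsilon> h"
  proof (rule funsI[OF isset_el[of B] isset_el[of B], of "\<lambda>k l. \<exists>j. pair k j \<epsilon> h \<and> pair j l \<epsilon> h"])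
    show "definable (\<lambda>e. \<exists>j. pair (e 0) j \<epsilon> h \<and> pair j (e 1) \<epsilon> h)" by (intro definability)
    show "\<exists>!l. l \<in> el B \<and> (\<exists>j. pair k j \<epsilon> h \<and> pair j l \<epsilon> h)" if "k \<in> el B" for k
      using that h_mem by (auto simp: pair_mem_funs[OF h])
  qed (rule that)
  have h2_eq: "app h2 k = app h (app h k)" if "k \<in> el B" for k
    using h2'[OF that] by (simp add: pair_mem_funs[OF h])
  \<comment> \<open>Iterating \<open>h2\<close> from \<open>m\<close> visits every second element of
    \<open>B\<close>. Any \<open>m\<close> will do, since the part of \<open>B\<close> below it is
    discarded.\<close>
  obtain m where m: "m \<in> el B" using unbounded_nonempty[OF B(2)] by blast
  obtain f where f: "f \<in> funs NN (el B)" and f_suc': "\<And>n. n \<in> NN \<Longrightarrow> app f (suc n) = app h2 (app f n)"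
    using recursion[OF isset_el h2 m] by blast
  have f_mem: "app f n \<in> el B" if "n \<in> NN" for n using app_mem[OF f that] .
  have f_suc: "app f (suc n) = app h (app h (app f n))" if "n \<in> NN" for n
    using f_suc'[OF that] h2_eq[OF f_mem[OF that]] by simp
  have f_step: "app f n \<epsilon> app f (suc n)" if "n \<in> NN" for n
  proof -
    have "app h (app f n) \<in> el B" using h_mem f_mem[OF that] by simp
    then have "app h (app h (app f n)) \<in> NN" "app h (app f n) \<epsilon> app h (app h (app f n))"
      using h_mem h_less B(1) by auto
    then show ?thesis unfolding f_suc[OF that] using h_less[OF f_mem[OF that]] NN_less_trans by blast
  qed
  define D where "D = {k \<in> el B. \<exists>n\<in>NN. pair n k \<epsilon> f}"
  have isset_D: "isset D" unfolding D_def by (intro isset_sep isset_el definability)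
  have D_B: "D \<subseteq> el B" by (auto simp: D_def)
  have f_D: "app f n \<in> D" if "n \<in> NN" for n
    using that f_mem by (auto simp: D_def pair_mem_funs[OF f])
  have D_f: "\<exists>n\<in>NN. k = app f n" if "k \<in> D" for k
    using that by (auto simp: D_def pair_mem_funs[OF f])
  have unb_D: "unbounded D"
  proof (rule unbounded_if_no_max[OF isset_D])
    show "D \<subseteq> NN" using D_B B(1) by blast
    show "D \<noteq> {}" using f_D[OF zero_NN] by blast
    show "\<exists>l\<in>D. k \<epsilon> l" if "k \<in> D" for k
      using D_f[OF that] f_D[OF suc_NN] f_step by blast
  qed
  \<comment> \<open>The successor in \<open>B\<close> of an element at an even position is at an odd
    one: if \<open>h(f(n)) = f(i)\<close>, then \<open>n < i\<close>, so
    \<open>f(n+1) \<le> f(i) = h(f(n)) < f(n+1)\<close>.\<close>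
  have D_h: "app h k \<notin> D" if k: "k \<in> D" for k
  proof
    assume "app h k \<in> D"
    then obtain i where i: "i \<in> NN" "app h k = app f i" using D_f by blast
    obtain n where n: "n \<in> NN" "k = app f n" using D_f[OF k] by blast
    have fi: "app f i \<in> NN" using f_mem[OF i(1)] B(1) by blast
    have less: "app f n \<epsilon> app f i" using h_less[OF f_mem[OF n(1)]] i(2) n(2) by simp
    have inc: "app f p \<epsilon> app f q" if "q \<in> NN" "p \<epsilon> q" for p q
      using increasing[OF f f_step B(1) that] .
    have "n \<epsilon> i" using NN_linear[OF n(1) i(1)] inc[OF n(1)] less NN_asym[OF fi] not_mem_self by metis
    then have "suc n = i \<or> suc n \<epsilon> i" using suc_le[OF i(1)] by blast
    then have "app f (suc n) = app f i \<or> app f (suc n) \<epsilon> app f i" using inc[OF i(1)] by blast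
    moreover have "app f i \<epsilon> app f (suc n)"
      using h_less[OF f_mem[OF i(1)]] f_suc[OF n(1)] i(2) n(2) by simp
    ultimately show False using NN_asym[OF fi] not_mem_self by metis
  qed
  \<comment> \<open>For \<open>k\<close> in \<open>D\<close>, the relation \<open>Q k v\<close> says
    that \<open>v\<close> is \<open>a(k,j)\<close>, where \<open>j\<close> is the partner
    \<open>app h k\<close> of \<open>k\<close>.\<close>
  define Q where "Q k v \<longleftrightarrow> k \<in> D \<and> (\<exists>j w. pair k j \<epsilon> h \<and> pair k w \<epsilon> g \<and> next_in (el w) j v)" for k v
  have Q_iff: "Q k v \<longleftrightarrow> k \<in> D \<and> next_in (el (app g k)) (app h k) v" for k v
    using D_B B(1) by (auto simp: Q_def pair_mem_funs[OF g] pair_mem_funs[OF h])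
  have Q_def': "definable (\<lambda>e. Q (e i) (e j))" for i j
    unfolding Q_def next_in_def by (intro definability definable_isset[OF isset_D])
  have Q_unique: "v = v'" if "Q k v" "Q k v'" for k v v'
  proof -
    have "k \<in> NN" using that(1) D_B B(1) Q_iff by blast
    then show ?thesis
      using that next_in_unique[OF member_NN[OF app_g_mem]] unfolding Q_iff by blast
  qed
  have Q_NN: "v \<in> NN" if "Q k v" for k v
  proof -
    have "k \<in> NN" "v \<in> el (app g k)" using that D_B B(1) by (auto simp: Q_iff next_in_def)
    then show ?thesis using member_NN[OF app_g_mem] by blast
  qed
  define X where "X = {v \<in> NN. \<exists>k. Q k v}"
  have isset_X: "isset X" unfolding X_def by (intro isset_sep isset_NN definability Q_def')
  have "unbounded X"
    unfolding unbounded_def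
  proof
    fix n assume "n \<in> NN"
    then obtain k where k: "k \<in> D" "n \<epsilon> k" using unb_D by (auto simp: unbounded_def)
    have kB: "k \<in> el B" using k(1) D_B by blast
    then have kN: "k \<in> NN" "app h k \<in> NN" using B(1) h_mem by auto
    then obtain v where v: "next_in (el (app g k)) (app h k) v"
      using next_in_exists[OF isset_el member_NN member_unbounded] app_g_mem by blast
    then have Q: "Q k v" using k(1) by (simp add: Q_iff)
    have "app h k \<epsilon> v" using v by (simp add: next_in_def)
    then have "n \<epsilon> v" using k(2) h_less[OF kB] kN Q_NN[OF Q] NN_less_trans by blast
    then show "\<exists>v\<in>X. n \<epsilon> v" using Q Q_NN by (auto simp: X_def)
  qed
  then obtain y where y: "y \<in> el A" "unbounded (X \<inter> el y)"
    using mad_meets[OF mad isset_X] by (auto simp: X_def)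
  define D' where "D' = {k \<in> D. \<exists>v. Q k v \<and> v \<epsilon> y}"
  have isset_D': "isset D'" unfolding D'_def by (intro isset_sep isset_D definability Q_def')
  have D'_D: "D' \<subseteq> D" by (auto simp: D'_def)
  \<comment> \<open>If \<open>D'\<close> were bounded, only boundedly many \<open>k\<close> could
    contribute to \<open>X \<inter> y\<close>, and \<open>image_bounded\<close> would bound that
    set.\<close>
  have unb_D': "unbounded D'"
    unfolding unbounded_def
  proof (rule ccontr)
    assume "\<not> (\<forall>n\<in>NN. \<exists>k\<in>D'. n \<epsilon> k)"
    then obtain n where n: "n \<in> NN" "\<And>k. k \<in> D' \<Longrightarrow> \<not> n \<epsilon> k" by blast
    have "\<exists>b\<in>NN. \<forall>k v. k \<epsilon> suc n \<and> Q k v \<longrightarrow> v \<epsilon> b"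
      by (rule image_bounded[where P = Q, OF suc_NN[OF n(1)] Q_def' Q_unique Q_NN])
    then obtain b where b: "b \<in> NN" "\<And>k v. k \<epsilon> suc n \<Longrightarrow> Q k v \<Longrightarrow> v \<epsilon> b" by blast
    obtain v where v: "v \<in> X" "v \<in> el y" "b \<epsilon> v" using y(2) b(1) by (auto simp: unbounded_def)
    then obtain k where k: "Q k v" by (auto simp: X_def)
    then have "k \<in> D'" using v(2) by (auto simp: D'_def Q_iff el_def)
    then have "\<not> n \<epsilon> k" "k \<in> NN" using n(2) D'_D D_B B(1) by auto
    then have "k \<epsilon> suc n" using NN_linear[OF n(1)] by auto
    then show False using b(2) k v(3) NN_asym[OF b(1)] by blast
  qed
  \<comment> \<open>The union of the pairs \<open>k\<close>, \<open>app h k\<close> with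
    \<open>k\<close> in \<open>D'\<close>. The set \<open>D'\<close> itself will be the
    \<open>E\<close> of \<open>captures\<close>.\<close>
  define Z where "Z = {j \<in> el B. j \<in> D' \<or> (\<exists>k\<in>D'. pair k j \<epsilon> h)}"
  have "isset Z" unfolding Z_def by (intro isset_sep isset_el definability definable_isset isset_D')
  then obtain z where z: "el z = Z" by (auto simp: isset_def)
  obtain E where E: "el E = D'" using isset_D' by (auto simp: isset_def)
  have E_iff: "k \<epsilon> E \<longleftrightarrow> k \<in> D'" for k unfolding E[symmetric] by (simp add: el_def)
  have D'_B: "k \<in> el B" if "k \<in> D'" for k using that D'_D D_B by blast
  have Z_iff: "j \<in> Z \<longleftrightarrow> j \<in> D' \<or> (\<exists>k\<in>D'. j = app h k)" for j
    using D'_B h_mem by (auto simp: Z_def pair_mem_funs[OF h])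
  have Z_B: "Z \<subseteq> el B" by (auto simp: Z_def)
  have BN: "k \<in> NN" if "k \<in> el B" for k using that B(1) by blast
  have "D' \<subseteq> Z" by (auto simp: Z_iff)
  then have unb_Z: "unbounded Z" by (rule unbounded_mono[OF unb_D'])
  have "captures y z E"
    unfolding captures_def z E E_iff
  proof (intro conjI ballI impI)
    fix k assume k: "k \<in> Z" "\<forall>i\<in>Z. i = k \<or> k \<epsilon> i"
    show "k \<in> D'"
    proof (rule ccontr)
      assume "k \<notin> D'"
      then obtain i where i: "i \<in> D'" "k = app h i" using k(1) Z_iff by blast
      then have "i \<epsilon> k" using h_less D'_B by simp
      moreover have "i = k \<or> k \<epsilon> i" using k(2) i(1) Z_iff by blast
      moreover have "k \<in> NN" using k(1) Z_B BN by blast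
      ultimately show False using NN_asym not_mem_self by blast
    qed
  next
    fix k assume k: "k \<in> D'"
    then have kB: "k \<in> el B" by (rule D'_B)
    let ?j = "app h k"
    have jB: "?j \<in> el B" and jZ: "?j \<in> Z" using h_mem[OF kB] k Z_iff by auto
    have j: "next_in Z k ?j" using h_next[OF kB] Z_B jZ by (auto simp: next_in_def)
    have jD: "?j \<notin> D" using D_h k D'_D by blast
    obtain l where l: "next_in Z ?j l"
      using next_in_exists[OF _ _ unb_Z] isset_el[of z] Z_B B(1) BN[OF jB] unfolding z by blast
    then have lZ: "l \<in> Z" and jl: "?j \<epsilon> l" and l_least: "\<And>i. i \<in> Z \<Longrightarrow> ?j \<epsilon> i \<Longrightarrow> i = l \<or> l \<epsilon> i"
      by (auto simp: next_in_def)
    have lN: "l \<in> NN" using lZ Z_B BN by blast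
    \<comment> \<open>Otherwise \<open>l\<close> is the partner of some \<open>i\<close> in
      \<open>D'\<close>. Since \<open>l\<close> is the next element of \<open>Z\<close> after
      \<open>?j\<close>, this \<open>i\<close> lies below \<open>?j\<close>, and then its successor
      \<open>l\<close> in \<open>B\<close> is at most \<open>?j\<close>.\<close>
    have "l \<in> D'"
    proof (rule ccontr)
      assume "l \<notin> D'"
      then obtain i where i: "i \<in> D'" "l = app h i" using lZ Z_iff by blast
      have iB: "i \<in> el B" by (rule D'_B[OF i(1)])
      have il: "i \<epsilon> l" using h_less[OF iB] i(2) by simp
      have "\<not> ?j \<epsilon> i" using l_least[of i] i(1) Z_iff il NN_asym[OF lN] not_mem_self by metis
      moreover have "i \<noteq> ?j" using jD i(1) D'_D by blast
      ultimately have ij: "i \<epsilon> ?j" using NN_linear[OF BN[OF iB] BN[OF jB]] by blast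
      have "l = ?j \<or> l \<epsilon> ?j" using h_least[OF iB jB ij] i(2) by auto
      then show False using jl NN_asym[OF lN] not_mem_self by metis
    qed
    obtain v where v: "Q k v" "v \<epsilon> y" using k by (auto simp: D'_def)
    show "\<exists>j l w v. next_in Z k j \<and> j \<notin> D' \<and> next_in Z j l \<and> l \<in> D' \<and>
        pair k w \<epsilon> g \<and> next_in (el w) j v \<and> v \<epsilon> y"
    proof (intro exI conjI)
      show "next_in Z k ?j" by (rule j)
      show "?j \<notin> D'" using jD D'_D by blast
      show "next_in Z ?j l" by (rule l)
      show "l \<in> D'" by fact
      show "pair k (app g k) \<epsilon> g" using BN[OF kB] by (simp add: pair_mem_funs[OF g])
      show "next_in (el (app g k)) ?j v" using v(1) by (simp add: Q_iff)
    qed (rule v)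
  qed
  moreover have "z \<in> inf_subsets NN" "z \<in> inf_subsets (el B)"
    using unb_Z Z_B B(1) by (auto simp: inf_subsets_iff z)
  ultimately show ?thesis using y(1) unfolding captured_def by blast
qed

text \<open>Excludes homogeneity by inclusion: a single \<open>y\<close> would equal the
  \<open>b\<close>-th set of the sequence for every \<open>b\<close> in \<open>B\<close>.\<close>

lemma exists_not_captured:
  assumes "B \<in> inf_subsets NN"
  shows "\<not> inf_subsets (el B) \<subseteq> captured"
proof
  assume homogeneous: "inf_subsets (el B) \<subseteq> captured"
  have B: "el B \<subseteq> NN" "unbounded (el B)" using assms by (simp_all add: inf_subsets_iff)
  have BN: "k \<in> NN" if "k \<in> el B" for k using that B(1) by blast
  have "B \<in> captured" using homogeneous B inf_subsets_iff[OF B(1)] by blast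
  then obtain y E where y: "y \<in> el A" and E: "captures y B E" by (auto simp: captured_def)
  have E_step: "\<exists>j l v. next_in (el B) k j \<and> next_in (el B) j l \<and> l \<epsilon> E \<and>
      next_in (el (app g k)) j v \<and> v \<epsilon> y" if "k \<epsilon> E" for k
  proof -
    have "k \<in> el E" using that by (simp add: el_def)
    then show ?thesis using E unfolding captures_def pair_mem_funs[OF g] by blast
  qed
  obtain b0 where b0: "b0 \<in> el B" "\<forall>i\<in>el B. i = b0 \<or> b0 \<epsilon> i"
    using NN_least[OF isset_el B(1) unbounded_nonempty[OF B(2)]] by blast
  then have "b0 \<epsilon> E" using E unfolding captures_def by blast
  \<comment> \<open>The least element of \<open>B\<close> is in \<open>E\<close>, and every element
    of \<open>E\<close> is followed two places later in \<open>B\<close> by another one.\<close>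
  have unb_E: "unbounded (el B \<inter> el E)"
  proof (rule unbounded_if_no_max[OF isset_Int])
    show "el B \<inter> el E \<noteq> {}" using b0(1) \<open>b0 \<epsilon> E\<close> by (auto simp: el_def)
    show "\<exists>l\<in>el B \<inter> el E. k \<epsilon> l" if "k \<in> el B \<inter> el E" for k
    proof -
      have "k \<epsilon> E" using that by (simp add: el_def)
      then obtain j l where "next_in (el B) k j" "next_in (el B) j l" "l \<epsilon> E" using E_step by blast
      then have "k \<epsilon> j" "j \<epsilon> l" "l \<in> el B" "l \<in> el E" by (auto simp: next_in_def el_def[of E])
      then show ?thesis using NN_less_trans[OF BN] by blast
    qed
  qed (use B(1) in blast)
  \<comment> \<open>Here \<open>b\<close> and \<open>c\<close> need not be consecutive in
    \<open>B\<close>: passing to a subset \<open>z\<close> makes them its first pair, and the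
    witness \<open>y'\<close> for \<open>z\<close> turns out to be \<open>y\<close>.\<close>
  have g_next_in_y: "\<exists>v. next_in (el (app g b)) c v \<and> v \<epsilon> y"
    if b: "b \<in> el B" and c: "c \<in> el B" and bc: "b \<epsilon> c" for b c
  proof -
    obtain d where d: "d \<in> el B" "d \<epsilon> E" "c \<epsilon> d"
      using unb_E BN[OF c] by (auto simp: unbounded_def el_def[of E])
    have bd: "b \<epsilon> d" using NN_less_trans[OF BN[OF d(1)] bc d(3)] .
    \<comment> \<open>With this tail of \<open>B\<close>, the first three elements of
      \<open>z\<close> are \<open>b\<close>, \<open>c\<close>, \<open>d\<close>. This puts
      \<open>b\<close> and \<open>d\<close> into \<open>E'\<close>, while \<open>d\<close> is in
      \<open>E\<close> by choice.\<close>
    define T where "T = {x \<in> el B. x = d \<or> d \<epsilon> x}"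
    have isset_T: "isset T" unfolding T_def by (intro isset_sep isset_el definability)
    define z where "z = mk (insert b (insert c T))"
    have z: "el z = insert b (insert c T)" by (simp add: z_def isset_T)
    have z_B: "el z \<subseteq> el B" using b c by (auto simp: z T_def)
    have above_d: "x \<in> el z \<longleftrightarrow> x \<in> el B" if "d = k \<or> d \<epsilon> k" "k \<epsilon> x" "k \<in> NN" "x \<in> NN" for k x
    proof
      assume "x \<in> el B"
      moreover have "d \<epsilon> x" using that NN_less_trans by metis
      ultimately show "x \<in> el z" by (simp add: z T_def)
    qed (use z_B in blast)
    have "unbounded (el z)"
      unfolding unbounded_def
    proof
      fix n assume n: "n \<in> NN"
      obtain m where m: "m \<in> NN" "\<And>x. x \<epsilon> suc n \<or> x \<epsilon> suc d \<Longrightarrow> x \<epsilon> m"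
        using NN_max[OF suc_NN[OF n] suc_NN[OF BN[OF d(1)]]] by blast
      then obtain k where k: "k \<in> el B" "m \<epsilon> k" using B(2) by (auto simp: unbounded_def)
      then have "n \<epsilon> k" "d \<epsilon> k" using m(2) NN_less_trans[OF BN[OF k(1)]] by auto
      then show "\<exists>k\<in>el z. n \<epsilon> k" using k(1) by (auto simp: z T_def)
    qed
    then have "z \<in> captured" using homogeneous inf_subsets_iff[OF B(1)] z_B by blast
    then obtain y' E' where y': "y' \<in> el A" and E': "captures y' z E'" by (auto simp: captured_def)
    have E'_step: "\<exists>j l v. next_in (el z) k j \<and> next_in (el z) j l \<and> l \<epsilon> E' \<and>
        next_in (el (app g k)) j v \<and> v \<epsilon> y'" if "k \<epsilon> E'" for k
    proof -
      have "k \<in> el E'" using that by (simp add: el_def)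
      then show ?thesis using E' unfolding captures_def pair_mem_funs[OF g] by blast
    qed
    have z_NN: "el z \<subseteq> NN" using z_B B(1) by blast
    have "b \<in> el z" "\<forall>i\<in>el z. i = b \<or> b \<epsilon> i"
      using bc bd NN_less_trans[OF BN] by (auto simp: z T_def)
    then have "b \<epsilon> E'" using E' unfolding captures_def by blast
    then obtain j l v where jlv: "next_in (el z) b j" "next_in (el z) j l" "l \<epsilon> E'"
      "next_in (el (app g b)) j v" "v \<epsilon> y'" using E'_step by blast
    have "next_in (el z) b c"
      using bc d(3) not_mem_self NN_less_trans[OF BN] by (auto simp: next_in_def z T_def)
    then have j: "j = c" using next_in_unique[OF z_NN] jlv(1) by blast
    have "next_in (el z) c d"
      using bc d(1,3) not_mem_self NN_asym[OF BN[OF c]] by (auto simp: next_in_def z T_def)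
    then have l: "l = d" using next_in_unique[OF z_NN] jlv(2) j by blast
    text \<open>Above \<open>d\<close>, which is in both \<open>E\<close> and \<open>E'\<close>, the sets \<open>B\<close> and \<open>z\<close> have the same elements;
      so \<open>y\<close> and \<open>y'\<close> have infinitely many elements in common.\<close>
    define D where "D = {k \<in> el B. (k = d \<or> d \<epsilon> k) \<and> k \<epsilon> E \<and> k \<epsilon> E'}"
    have isset_D: "isset D" unfolding D_def by (intro isset_sep isset_el definability)
    \<comment> \<open>From \<open>k\<close> in \<open>D\<close>, the next two elements
      \<open>j\<close>, \<open>l\<close> are the same in \<open>B\<close> and in \<open>z\<close>.
      So \<open>l\<close> is in \<open>D\<close> again, and \<open>a(k,j)\<close> lies in both
      \<open>y\<close> and \<open>y'\<close>.\<close>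
    have D_step: "(\<exists>l\<in>D. k \<epsilon> l) \<and> (\<exists>v\<in>el y \<inter> el y'. k \<epsilon> v)" if k: "k \<in> D" for k
    proof -
      have kB: "k \<in> el B" and kE: "k \<epsilon> E" "k \<epsilon> E'" and dk: "d = k \<or> d \<epsilon> k" using k by (auto simp: D_def)
      obtain j l v where 1: "next_in (el B) k j" "next_in (el B) j l" "l \<epsilon> E"
        "next_in (el (app g k)) j v" "v \<epsilon> y" using E_step[OF kE(1)] by blast
      obtain j' l' v' where 2: "next_in (el z) k j'" "next_in (el z) j' l'" "l' \<epsilon> E'"
        "next_in (el (app g k)) j' v'" "v' \<epsilon> y'" using E'_step[OF kE(2)] by blast
      have kN: "k \<in> NN" by (rule BN[OF kB])
      have same: "next_in (el z) k j \<longleftrightarrow> next_in (el B) k j" if "d = k \<or> d \<epsilon> k" "k \<in> NN" for k j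
        using above_d[OF that(1) _ that(2)] z_NN B(1) unfolding next_in_def by blast
      have jB: "j \<in> el B" and kj: "k \<epsilon> j" using 1(1) by (auto simp: next_in_def)
      have j: "j' = j" using same[OF dk kN] 1(1) 2(1) next_in_unique[OF B(1)] by blast
      have dj: "d \<epsilon> j" using dk kj NN_less_trans[OF BN[OF jB]] by blast
      then have l: "l' = l" using same[of j] BN[OF jB] 1(2) 2(2) j next_in_unique[OF B(1)] by blast
      have lB: "l \<in> el B" and jl: "j \<epsilon> l" using 1(2) by (auto simp: next_in_def)
      have "l \<in> D" using lB 1(3) 2(3) l NN_less_trans[OF BN[OF lB] dj jl] by (simp add: D_def)
      moreover have "k \<epsilon> l" using NN_less_trans[OF BN[OF lB] kj jl] .
      moreover have v: "v' = v" using 1(4) 2(4) j next_in_unique[OF member_NN[OF app_g_mem[OF kN]]] by blast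
      moreover have "v \<in> el y \<inter> el y'" using 1(5) 2(5) v by (simp add: el_def)
      moreover have "k \<epsilon> v"
      proof -
        have "v \<in> NN" using \<open>v \<in> el y \<inter> el y'\<close> member_NN[OF y] by blast
        moreover have "j \<epsilon> v" using 1(4) by (simp add: next_in_def)
        ultimately show ?thesis using kj NN_less_trans by blast
      qed
      ultimately show ?thesis by blast
    qed
    have "d \<in> D" using d jlv(3) l by (simp add: D_def)
    have unb_D: "unbounded D"
      by (rule unbounded_if_no_max[OF isset_D]) (use D_step \<open>d \<in> D\<close> B(1) in \<open>auto simp: D_def\<close>)
    have "unbounded (el y \<inter> el y')"
      unfolding unbounded_def
    proof
      fix n assume "n \<in> NN"
      then obtain k where k: "k \<in> D" "n \<epsilon> k" using unb_D by (auto simp: unbounded_def)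
      then obtain v where v: "v \<in> el y \<inter> el y'" "k \<epsilon> v" using D_step by blast
      then have "v \<in> NN" using member_NN[OF y] by blast
      then show "\<exists>v\<in>el y \<inter> el y'. n \<epsilon> v" using v k(2) NN_less_trans by blast
    qed
    then have "y = y'" using almost_disjoint_eqI[OF almost_disjoint y y'] by blast
    then show ?thesis using jlv(4,5) j by blast
  qed
  \<comment> \<open>The numbers \<open>a(b,c)\<close>, with \<open>c\<close> arbitrarily large in
    \<open>B\<close>, are common elements of \<open>app g b\<close> and \<open>y\<close>.\<close>
  have g_eq_y: "app g b = y" if b: "b \<in> el B" for b
  proof (rule almost_disjoint_eqI[OF almost_disjoint app_g_mem[OF BN[OF b]] y])
    show "unbounded (el (app g b) \<inter> el y)"
      unfolding unbounded_def
    proof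
      fix n assume n: "n \<in> NN"
      obtain m where m: "m \<in> NN" "\<And>x. x \<epsilon> suc n \<or> x \<epsilon> suc b \<Longrightarrow> x \<epsilon> m"
        using NN_max[OF suc_NN[OF n] suc_NN[OF BN[OF b]]] by blast
      then obtain c where c: "c \<in> el B" "m \<epsilon> c" using B(2) by (auto simp: unbounded_def)
      then have nc: "n \<epsilon> c" and bc: "b \<epsilon> c" using m(2) NN_less_trans[OF BN[OF c(1)]] by auto
      then obtain v where v: "next_in (el (app g b)) c v" "v \<epsilon> y" using g_next_in_y[OF b c(1)] by blast
      then have v': "v \<in> el (app g b) \<inter> el y" "c \<epsilon> v" by (auto simp: next_in_def el_def[of y])
      then have "v \<in> NN" using member_NN[OF y] by blast
      then show "\<exists>v\<in>el (app g b) \<inter> el y. n \<epsilon> v" using v' nc NN_less_trans by blast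
    qed
  qed
  \<comment> \<open>Two different elements of \<open>B\<close> now index the same set
    \<open>y\<close>, contradicting the injectivity of the sequence.\<close>
  obtain c where "c \<in> el B" "b0 \<epsilon> c" using B(2) BN[OF b0(1)] by (auto simp: unbounded_def)
  then show False using g_eq_y b0(1) inj_onD[OF inj, of b0 c] BN not_mem_self by metis
qed

lemma captured_not_Ramsey: "\<not> Ramsey_property (mk captured)"
  using exists_captured exists_not_captured unfolding Ramsey_property_def el_mk[OF isset_captured]
  by blast

end

theorem theorem1p1:
  fixes mem :: "'a \<Rightarrow> 'a \<Rightarrow> bool"
  assumes "set_structure.ZF mem"
    and "set_structure.DC mem"
    and "set_structure.R_Unif mem"
    and "\<forall>S. set_structure.el mem S \<subseteq> set_structure.inf_subsets mem (set_structure.NN mem)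
              \<longrightarrow> set_structure.Ramsey_property mem S"
  shows "\<not> (\<exists>A. set_structure.mad mem A \<and>
                 \<not> set_structure.fin mem (set_structure.el mem A))"
proof
  interpret zf_structure mem by unfold_locales (rule assms(1))
  assume "\<exists>A. mad A \<and> \<not> fin (el A)"
  then obtain A where A: "mad A" "\<not> fin (el A)" by blast
  obtain g where "g \<in> funs NN (el A)" "inj_on (app g) NN"
    using infinite_sequence[OF assms(2) A(2)] by blast
  then interpret mad_sequence mem A g by unfold_locales (rule A(1))
  have "el (mk captured) \<subseteq> inf_subsets NN"
    unfolding el_mk[OF isset_captured] by (auto simp: captured_def)
  then show False using assms(4) captured_not_Ramsey by blast
qed

end
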